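(* Let $n \ge 3$ and $m\ge 1$ be integers, let $q$ be a real number with $q > \frac{n+2}{n}$ and $q \ne \frac{n+2}{n-2}$, and let $p = \frac{n}{2}(q-1)$. Let $A = (A_{ij})$ be a constant, symmetric, positive definite real $m\times m$ matrix, and let $P : \mathbb{R}^m\to\mathbb{R}$ be a $C^2$ function that is homogeneous of degree $q+1$. Let $V = (V_1,\dots,V_m) : \mathbb{R}^n\to\mathbb{R}^m$ be a (classical, $C^2$) solution of $$\sum_{j=1}^m A_{ij}\,\Delta V_j = \frac{\partial P}{\partial V_i}(V), \qquad i=1,\dots,m,\quad \text{in } \mathbb{R}^n,$$ with $V\in L^p(\mathbb{R}^n)$. Then $V\equiv 0$.
   Context: $\Delta$ is the Euclidean Laplacian on $\mathbb{R}^n$, applied to each component. A function $P:\mathbb{R}^m\to\mathbb{R}$ is homogeneous of degree $d$ if $P(tv) = t^d P(v)$ for all $t>0$ and $v\in\mathbb{R}^m$. No sign condition is imposed on $V_i$ or $P$. *)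

theory Defs
  imports "HOL-Analysis.Analysis"
begin

text \<open>
  \<open>C_k n f\<close>: the function \<open>f\<close> is \<open>n\<close> times continuously differentiable on the whole space. The
  directional derivatives \<open>\<lambda>x. f'(x) v\<close> of a differentiable function are again functions on the
  space, and in finite dimension continuity of all of them is continuity of the derivative.
\<close>

fun C_k :: "nat \<Rightarrow> ('a::euclidean_space \<Rightarrow> 'b::real_normed_vector) \<Rightarrow> bool" where
  "C_k 0 f \<longleftrightarrow> continuous_on UNIV f"
| "C_k (Suc n) f \<longleftrightarrow>
     (\<forall>x. f differentiable (at x)) \<and> (\<forall>v. C_k n (\<lambda>x. frechet_derivative f (at x) v))"

definition partial_deriv :: "'n::finite \<Rightarrow> (real^'n \<Rightarrow> real) \<Rightarrow> real^'n \<Rightarrow> real" where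
  "partial_deriv k f x = deriv (\<lambda>t. f (x + t *\<^sub>R axis k 1)) 0"

lemma partial_deriv_eq_frechet_derivative:
  assumes "f differentiable (at x)"
  shows "partial_deriv k f x = frechet_derivative f (at x) (axis k 1)"
proof -
  have f: "(f has_derivative frechet_derivative f (at x)) (at (x + 0 *\<^sub>R axis k 1))"
    using assms by (simp add: frechet_derivative_works)
  have "((\<lambda>t. f (x + t *\<^sub>R axis k 1)) has_derivative
      (\<lambda>t. frechet_derivative f (at x) (t *\<^sub>R axis k 1))) (at 0)"
    by (rule has_derivative_compose[where g = f and f = "\<lambda>t. x + t *\<^sub>R axis k 1", OF _ f]) (auto intro!: derivative_eq_intros)
  then have "((\<lambda>t. f (x + t *\<^sub>R axis k 1)) has_field_derivative
      frechet_derivative f (at x) (axis k 1)) (at 0)"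
    unfolding has_field_derivative_def
    using linear_frechet_derivative[OF assms]
    by (auto simp: linear_cmul mult.commute elim!: has_derivative_eq_rhs)
  then show ?thesis
    unfolding partial_deriv_def by (rule DERIV_imp_deriv)
qed

definition laplacian :: "(real^'n::finite \<Rightarrow> real) \<Rightarrow> real^'n \<Rightarrow> real" where
  "laplacian f x = (\<Sum>k\<in>UNIV. partial_deriv k (partial_deriv k f) x)"

definition positive_definite :: "real^'m^'m::finite \<Rightarrow> bool" where
  "positive_definite A \<longleftrightarrow> (\<forall>v. v \<noteq> 0 \<longrightarrow> 0 < v \<bullet> (A *v v))"

definition pos_homogeneous :: "real \<Rightarrow> ('a::real_vector \<Rightarrow> real) \<Rightarrow> bool" where
  "pos_homogeneous d P \<longleftrightarrow> (\<forall>t>0. \<forall>v. P (t *\<^sub>R v) = t powr d * P v)"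

text \<open>Membership in \<open>L\<^sup>p\<close> of the Lebesgue measure, for finite exponents \<open>p > 0\<close>.\<close>

definition in_Lp :: "real \<Rightarrow> ('a::euclidean_space \<Rightarrow> 'b::euclidean_space) \<Rightarrow> bool" where
  "in_Lp p f \<longleftrightarrow>
     f \<in> borel_measurable lebesgue \<and> integrable lebesgue (\<lambda>x. norm (f x) powr p)"

end

theory Submission
  imports Defs
begin

text \<open>
  Write \<open>Q = V \<bullet> A V\<close>, \<open>e = \<Sum>\<^sub>b \<partial>\<^sub>bV \<bullet> A \<partial>\<^sub>bV\<close>, \<open>s = (q - 1) / 2\<close> and let \<open>n\<close> be the dimension of the domain.
  Euler's identity for the homogeneous function \<open>P\<close> turns the system into the scalar equation
  \<open>\<Delta>Q = 2 e + 2 (q + 1) P(V)\<close>, and \<open>\<bar>P(V)\<bar> \<le> K Q\<^bsup>1+s\<^esup>\<close>. So \<open>Q \<ge> 0\<close> satisfies \<open>\<Delta>Q \<ge> - C Q\<^bsup>1+s\<^esup>\<close>,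
  whatever the sign of \<open>P\<close>, and the hypothesis says that \<open>Q\<^bsup>ns/2\<^esup>\<close> is integrable. This integral is
  invariant under the scaling of the inequality.

  The energy is made to vanish by an identity of Pohozaev type. The vector field with components
  \<open>(x \<bullet> \<nabla>V) \<bullet> A \<partial>\<^sub>bV - x\<^sub>b (e / 2 + P(V)) + n / (q + 1) V \<bullet> A \<partial>\<^sub>bV\<close> has divergence
  \<open>(1 - n / 2 + n / (q + 1)) e\<close>; the last summand, again by Euler's identity, is what removes \<open>P(V)\<close>.
  The constant in front of \<open>e\<close> vanishes exactly for the critical exponent \<open>q = (n + 2) / (n - 2)\<close>.
  Integrating against a cutoff at radius \<open>R\<close> bounds the energy of a fixed cube by the integral of
  \<open>e + Q / R\<^sup>2 + \<bar>P(V)\<bar>\<close> over the annulus \<open>R \<le> \<bar>x\<bar> \<le> 2 R\<close>, and Green's identity for \<open>Q\<close> bounds the energy of the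
  annulus by \<open>\<integral> Q / R\<^sup>2 + \<bar>P(V)\<bar>\<close> there (\<open>energy_bound\<close>). If \<open>Q = O(\<bar>x\<bar>\<^bsup>-2\<gamma>\<^esup>)\<close> with
  \<open>2 \<gamma> > n - 2\<close>, and \<open>Q\<^bsup>s\<^esup> = O(\<bar>x\<bar>\<^bsup>-2\<^esup>)\<close>, this tends to \<open>0\<close>. Then \<open>e = 0\<close>, \<open>V\<close> is constant,
  and it decays, so it is zero (\<open>trivial_if_fast_decay\<close>).

  It remains to find the decay. First, \<open>\<bar>x\<bar>\<^sup>2 Q\<^bsup>s\<^esup> \<rightarrow> 0\<close> at infinity (\<open>scale_invariant_decay\<close>): where the
  scale invariant integral of \<open>Q\<close> is small, \<open>Q\<close> is small in the scale invariant sense. This is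
  shown by picking a point at which \<open>(\<rho> - \<bar>x - y\<bar>)\<^sup>2 Q\<^bsup>s\<^esup>\<close> is maximal, because near such a point \<open>Q\<close> is
  comparable to its value there and the mean value inequality of almost subharmonic functions applies on
  the natural length scale. If \<open>q\<close> is subcritical then \<open>2 / s > n - 2\<close>, and \<open>\<gamma> = 1 / s\<close> is good enough.
  If \<open>q\<close> is supercritical, then \<open>\<Delta>Q \<ge> - C Q\<^bsup>s\<^esup> Q\<close> has a potential \<open>C Q\<^bsup>s\<^esup>\<close>
  that is small compared with \<open>\<bar>x\<bar>\<^bsup>-2\<^esup>\<close> far out, and the maximum principle for \<open>\<surd>Q\<close> improves the slow decay \<open>\<bar>x\<bar>\<^bsup>-1/s\<^esup>\<close> to
  the fast decay \<open>\<bar>x\<bar>\<^bsup>-(n-2-1/s)\<^esup>\<close> (\<open>exterior_decay\<close>), and \<open>\<gamma> = n - 2 - 1 / s > (n - 2) / 2\<close>.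
\<close>

section \<open>Twice continuously differentiable functions and integration by parts\<close>

text \<open>
  Derivatives are carried as functions of the base point and of the directions, in the order in which
  the directions are taken: \<open>f'' x u v\<close> differentiates \<open>f' y u\<close> at \<open>y = x\<close> in direction \<open>v\<close>. In finite
  dimension continuity of \<open>f'' x u v\<close> in \<open>x\<close> for fixed \<open>u\<close>, \<open>v\<close> is continuity of the second derivative.
\<close>

definition C2_deriv ::
  "('a::euclidean_space \<Rightarrow> 'b::euclidean_space) \<Rightarrow> ('a \<Rightarrow> 'a \<Rightarrow> 'b) \<Rightarrow> ('a \<Rightarrow> 'a \<Rightarrow> 'a \<Rightarrow> 'b) \<Rightarrow> bool"
where
  "C2_deriv f f' f'' \<longleftrightarrow>
     (\<forall>x. (f has_derivative f' x) (at x)) \<and>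
     (\<forall>x v. ((\<lambda>y. f' y v) has_derivative f'' x v) (at x)) \<and>
     (\<forall>u v. continuous_on UNIV (\<lambda>x. f'' x u v))"

lemma C_k_2_imp_C2_deriv:
  assumes "C_k 2 f"
  shows "C2_deriv f (\<lambda>x. frechet_derivative f (at x))
           (\<lambda>x v. frechet_derivative (\<lambda>y. frechet_derivative f (at y) v) (at x))"
  using assms
  by (simp add: C2_deriv_def numeral_2_eq_2 frechet_derivative_works[symmetric])

lemma
  assumes "C2_deriv f f' f''"
  shows C2_deriv_D1: "(f has_derivative f' x) (at x)"
    and C2_deriv_D2: "((\<lambda>y. f' y v) has_derivative f'' x v) (at x)"
    and C2_deriv_cont0: "continuous_on S f"
    and C2_deriv_cont1: "continuous_on S (\<lambda>x. f' x v)"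
    and C2_deriv_cont2: "continuous_on S (\<lambda>x. f'' x u v)"
    and C2_deriv_linear1: "linear (f' x)"
    and C2_deriv_linear2: "linear (f'' x v)"
proof -
  show 1: "(f has_derivative f' x) (at x)" and 2: "((\<lambda>y. f' y v) has_derivative f'' x v) (at x)" for x v
    using assms by (auto simp: C2_deriv_def)
  show "continuous_on S f"
    using 1 by (meson has_derivative_at_withinI has_derivative_continuous_on)
  show "continuous_on S (\<lambda>x. f' x v)"
    using 2[of v] by (meson has_derivative_at_withinI has_derivative_continuous_on)
  show "continuous_on S (\<lambda>x. f'' x u v)"
    using assms unfolding C2_deriv_def by (meson continuous_on_subset subset_UNIV)
  show "linear (f' x)" "linear (f'' x v)"
    using 1 2 has_derivative_linear by blast+
qed

lemma linear_Basis_expand: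
  assumes "linear L"
  shows "L x = (\<Sum>b\<in>Basis. (x \<bullet> b) *\<^sub>R L b)"
proof -
  have "L x = L (\<Sum>b\<in>Basis. (x \<bullet> b) *\<^sub>R b)" by (simp add: euclidean_representation)
  also have "\<dots> = (\<Sum>b\<in>Basis. (x \<bullet> b) *\<^sub>R L b)"
    using assms by (simp add: linear_sum linear_cmul)
  finally show ?thesis .
qed

lemma has_derivative_along_line:
  assumes "\<And>x. (f has_derivative f' x) (at x)"
  shows "((\<lambda>t::real. f (x + t *\<^sub>R v)) has_vector_derivative f' (x + t *\<^sub>R v) v) (at t within S)"
proof -
  have lin: "linear (f' (x + t *\<^sub>R v))" using assms has_derivative_linear by blast
  have "((\<lambda>t. f (x + t *\<^sub>R v)) has_derivative (\<lambda>h. f' (x + t *\<^sub>R v) (h *\<^sub>R v))) (at t within S)"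
    by (rule has_derivative_compose[where f = "\<lambda>t. x + t *\<^sub>R v" and g = f, OF _ assms])
       (auto intro!: derivative_eq_intros)
  then show ?thesis
    by (simp add: has_vector_derivative_def linear_cmul[OF lin])
qed

text \<open>
  By the fundamental theorem of calculus \<open>f (x + s u + t v)\<close> is \<open>f (x + s u)\<close> plus the integral of
  \<open>f' (x + s u + \<tau> v) v\<close> over \<open>0 \<le> \<tau> \<le> t\<close>. Differentiating in \<open>s\<close> under the integral and then in \<open>t\<close>
  takes the two derivatives in the other order.
\<close>

lemma second_derivative_symmetric:
  assumes "C2_deriv f f' f''"
  shows "f'' x u v = f'' x v u"
proof -
  note c2 = C2_deriv_cont2[OF assms]
  have integ: "(\<lambda>\<tau>. f'' (x + s *\<^sub>R u + \<tau> *\<^sub>R v) v u) integrable_on {0..t}" for s t :: real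
    by (intro integrable_continuous_interval continuous_on_compose2[OF c2[of UNIV v u]] continuous_intros) auto
  have cv: "continuous_on A (\<lambda>\<tau>. f' (x + s *\<^sub>R u + \<tau> *\<^sub>R v) v)" for s :: real and A
    by (intro continuous_on_compose2[OF C2_deriv_cont1[OF assms, of UNIV v]] continuous_intros) auto
  \<comment> \<open>Integrate along \<open>v\<close>, then differentiate under the integral along \<open>u\<close>.\<close>
  have ftc: "f (x + s *\<^sub>R u + t *\<^sub>R v) = f (x + s *\<^sub>R u) + integral {0..t} (\<lambda>\<tau>. f' (x + s *\<^sub>R u + \<tau> *\<^sub>R v) v)"
    if "0 \<le> t" for s t :: real
  proof -
    have "((\<lambda>\<tau>. f' (x + s *\<^sub>R u + \<tau> *\<^sub>R v) v) has_integral
        f (x + s *\<^sub>R u + t *\<^sub>R v) - f (x + s *\<^sub>R u + 0 *\<^sub>R v)) {0..t}"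
      by (rule fundamental_theorem_of_calculus[OF that has_derivative_along_line])
         (rule C2_deriv_D1[OF assms])
    then show ?thesis by (simp add: integral_unique)
  qed
  have diff: "f' (x + t *\<^sub>R v) u = f' x u + integral {0..t} (\<lambda>\<tau>. f'' (x + \<tau> *\<^sub>R v) v u)" if "0 \<le> t" for t
  proof -
    have "((\<lambda>s. integral (cbox 0 t) (\<lambda>\<tau>. f' (x + s *\<^sub>R u + \<tau> *\<^sub>R v) v)) has_vector_derivative
        integral (cbox 0 t) (\<lambda>\<tau>. f'' (x + 0 *\<^sub>R u + \<tau> *\<^sub>R v) v u)) (at 0 within UNIV)"
    proof (rule leibniz_rule_vector_derivative)
      show "((\<lambda>s. f' (x + s *\<^sub>R u + \<tau> *\<^sub>R v) v) has_vector_derivative f'' (x + s *\<^sub>R u + \<tau> *\<^sub>R v) v u) (at s within UNIV)"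
        for s \<tau> :: real
        using has_derivative_along_line[OF C2_deriv_D2[OF assms, of v], of "x + \<tau> *\<^sub>R v" u s UNIV]
        by (simp add: algebra_simps)
      show "continuous_on (UNIV \<times> cbox 0 t) (\<lambda>(s, \<tau>). f'' (x + s *\<^sub>R u + \<tau> *\<^sub>R v) v u)"
        unfolding split_beta
        by (intro continuous_on_compose2[OF c2[of UNIV v u]] continuous_intros) auto
    qed (auto intro!: integrable_continuous_interval cv)
    then have "((\<lambda>s. f (x + s *\<^sub>R u) + integral {0..t} (\<lambda>\<tau>. f' (x + s *\<^sub>R u + \<tau> *\<^sub>R v) v)) has_vector_derivative
       f' (x + 0 *\<^sub>R u) u + integral {0..t} (\<lambda>\<tau>. f'' (x + \<tau> *\<^sub>R v) v u)) (at 0)"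
      by (intro has_vector_derivative_add has_derivative_along_line[OF C2_deriv_D1[OF assms]]) auto
    moreover have "((\<lambda>s. f (x + t *\<^sub>R v + s *\<^sub>R u)) has_vector_derivative f' (x + t *\<^sub>R v + 0 *\<^sub>R u) u) (at 0)"
      by (rule has_derivative_along_line[OF C2_deriv_D1[OF assms]])
    moreover have "(\<lambda>s. f (x + t *\<^sub>R v + s *\<^sub>R u)) =
        (\<lambda>s. f (x + s *\<^sub>R u) + integral {0..t} (\<lambda>\<tau>. f' (x + s *\<^sub>R u + \<tau> *\<^sub>R v) v))"
      using ftc[OF that] by (simp add: algebra_simps)
    ultimately show ?thesis
      using vector_derivative_unique_at by fastforce
  qed
  have "((\<lambda>t. f' x u + integral {0..t} (\<lambda>\<tau>. f'' (x + \<tau> *\<^sub>R v) v u)) has_vector_derivative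
      f'' (x + 0 *\<^sub>R v) v u) (at 0 within {0..1})"
  proof -
    have "continuous_on {0..1} (\<lambda>\<tau>. f'' (x + \<tau> *\<^sub>R v) v u)"
      by (intro continuous_on_compose2[OF c2[of UNIV v u]] continuous_intros) auto
    from integral_has_vector_derivative[OF this, of 0]
    have "((\<lambda>t. integral {0..t} (\<lambda>\<tau>. f'' (x + \<tau> *\<^sub>R v) v u)) has_vector_derivative
        f'' (x + 0 *\<^sub>R v) v u) (at 0 within {0..1})" by simp
    from has_vector_derivative_add[OF has_vector_derivative_const this] show ?thesis by simp
  qed
  then have "((\<lambda>t. f' (x + t *\<^sub>R v) u) has_vector_derivative f'' (x + 0 *\<^sub>R v) v u) (at 0 within {0..1})"
    by (rule has_vector_derivative_transform[rotated 2]) (auto simp: diff)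
  moreover have "((\<lambda>t. f' (x + t *\<^sub>R v) u) has_vector_derivative f'' (x + 0 *\<^sub>R v) u v) (at 0 within {0..1})"
    by (rule has_derivative_along_line[OF C2_deriv_D2[OF assms]])
  ultimately show ?thesis
    using vector_derivative_unique_within_closed_interval[of 0 1 0] by fastforce
qed

text \<open>
  The integral of a compactly supported function does not change when the function is translated along
  \<open>v\<close>, and its derivative with respect to the translation is the integral of \<open>f' x v\<close>.
\<close>

lemma integral_derivative_eq_0:
  fixes f :: "'a::euclidean_space \<Rightarrow> real"
  assumes der: "\<And>x. (f has_derivative f' x) (at x)"
    and cont: "continuous_on UNIV (\<lambda>x. f' x v)"
    and supp: "\<And>x. x \<notin> cbox a b \<Longrightarrow> f x = 0"
  shows "integral (cbox a b) (\<lambda>x. f' x v) = 0"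
proof -
  define c where "c = (\<Sum>i\<in>Basis. \<bar>v \<bullet> i\<bar> *\<^sub>R i)"
  have c: "c \<bullet> i = \<bar>v \<bullet> i\<bar>" if "i \<in> Basis" for i
    using that by (simp add: c_def inner_sum_left inner_Basis if_distrib cong: if_cong)
  have cf: "continuous_on S f" for S
    by (meson der has_derivative_at_withinI has_derivative_continuous_on)
  have vanish: "f' x v = 0" if "x \<notin> cbox a b" for x
  proof -
    have "(f has_derivative (\<lambda>_. 0)) (at x)"
      by (rule has_derivative_transform_within_open[of "\<lambda>_. 0" _ _ _ "- cbox a b"])
         (use that supp in auto)
    then show ?thesis using der has_derivative_unique by metis
  qed
  \<comment> \<open>The enlarged box contains the translates of the support by \<open>t *\<^sub>R v\<close> with \<open>\<bar>t\<bar> \<le> 1\<close>.\<close>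
  let ?B = "cbox (a - c) (b + c)"
  have J: "integral ?B (\<lambda>x. f (x + t *\<^sub>R v)) = integral UNIV f" if t: "\<bar>t\<bar> \<le> 1" for t
  proof -
    have *: "(\<lambda>x. f (x + t *\<^sub>R v)) x = 0" if x: "x \<notin> ?B" for x
    proof (rule ccontr)
      assume "\<not> ?thesis"
      then have "x + t *\<^sub>R v \<in> cbox a b" using supp by force
      moreover have "\<bar>t * (v \<bullet> i)\<bar> \<le> c \<bullet> i" if "i \<in> Basis" for i
        using t c[OF that] mult_left_le_one_le[of "\<bar>v \<bullet> i\<bar>" "\<bar>t\<bar>"] by (simp add: abs_mult)
      ultimately have "x \<in> ?B" by (force simp: mem_box inner_simps abs_le_iff)
      then show False using x by simp
    qed
    have "integral ?B (\<lambda>x. f (x + t *\<^sub>R v)) = integral UNIV (\<lambda>x. f (x + t *\<^sub>R v))"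
      by (subst integral_restrict_UNIV[symmetric]) (use * in \<open>auto intro!: integral_cong\<close>)
    also have "\<dots> = integral UNIV f"
    proof -
      have "(f has_integral integral (cbox a b) f) (cbox a b)"
        by (intro integrable_integral integrable_continuous cf)
      from has_integral_shift_cbox[OF this, of "t *\<^sub>R v"]
      have "((\<lambda>x. f (x + t *\<^sub>R v)) has_integral integral (cbox a b) f) (cbox (a - t *\<^sub>R v) (b - t *\<^sub>R v))" .
      then have "((\<lambda>x. f (x + t *\<^sub>R v)) has_integral integral (cbox a b) f) UNIV"
        by (rule has_integral_on_superset) (auto simp: mem_box inner_simps algebra_simps intro!: supp)
      moreover have "(f has_integral integral (cbox a b) f) UNIV"
        by (rule has_integral_on_superset[where S = "cbox a b"])
          (auto intro!: integrable_integral integrable_continuous cf supp)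
      ultimately show ?thesis by (simp add: integral_unique)
    qed
    finally show ?thesis .
  qed
  have "((\<lambda>t. integral ?B (\<lambda>x. f (x + t *\<^sub>R v))) has_vector_derivative
      integral ?B (\<lambda>x. f' (x + 0 *\<^sub>R v) v)) (at 0 within {-1..1})"
  proof (rule leibniz_rule_vector_derivative)
    show "((\<lambda>t. f (x + t *\<^sub>R v)) has_vector_derivative f' (x + t *\<^sub>R v) v) (at t within {-1..1})" for t x
      by (rule has_derivative_along_line[OF der])
    show "continuous_on ({-1..1} \<times> ?B) (\<lambda>(t, x). f' (x + t *\<^sub>R v) v)"
      unfolding split_beta by (intro continuous_on_compose2[OF cont] continuous_intros) auto
  qed (auto intro!: integrable_continuous continuous_on_compose2[OF cf] continuous_intros)
  moreover have "((\<lambda>t. integral ?B (\<lambda>x. f (x + t *\<^sub>R v))) has_vector_derivative 0) (at 0 within {-1..1})"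
    by (rule has_vector_derivative_transform[where f="\<lambda>_. integral UNIV f"]) (auto simp: J)
  ultimately have "integral ?B (\<lambda>x. f' x v) = 0"
    using vector_derivative_unique_within_closed_interval[of "-1" 1 0] by fastforce
  also have "integral ?B (\<lambda>x. f' x v) = integral (cbox a b) (\<lambda>x. f' x v)"
  proof (rule integral_unique, rule has_integral_on_superset)
    show "((\<lambda>x. f' x v) has_integral integral (cbox a b) (\<lambda>x. f' x v)) (cbox a b)"
      by (intro integrable_integral integrable_continuous continuous_on_subset[OF cont]) auto
    show "cbox a b \<subseteq> ?B"
      unfolding subset_box using c by (force simp: inner_simps)
  qed (rule vanish)
  finally show ?thesis .
qed

lemma integral_divergence_eq_0:
  fixes F :: "'a::euclidean_space \<Rightarrow> 'a \<Rightarrow> real"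
  assumes der: "\<And>b x. b \<in> Basis \<Longrightarrow> (F b has_derivative F' b x) (at x)"
    and cont: "\<And>b. b \<in> Basis \<Longrightarrow> continuous_on UNIV (\<lambda>x. F' b x b)"
    and supp: "\<And>b x. b \<in> Basis \<Longrightarrow> x \<notin> cbox lo hi \<Longrightarrow> F b x = 0"
  shows "integral (cbox lo hi) (\<lambda>x. \<Sum>b\<in>Basis. F' b x b) = 0"
proof -
  have "integral (cbox lo hi) (\<lambda>x. \<Sum>b\<in>Basis. F' b x b) = (\<Sum>b\<in>Basis. integral (cbox lo hi) (\<lambda>x. F' b x b))"
    by (intro integral_sum integrable_continuous) (auto intro: continuous_on_subset[OF cont])
  also have "\<dots> = 0"
    by (intro sum.neutral ballI integral_derivative_eq_0[of "F b" for b]) (use assms in auto)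
  finally show ?thesis .
qed

definition lap :: "('a::euclidean_space \<Rightarrow> 'a \<Rightarrow> 'a \<Rightarrow> 'b::real_normed_vector) \<Rightarrow> 'a \<Rightarrow> 'b" where
  "lap f'' x = (\<Sum>b\<in>Basis. f'' x b b)"

lemma continuous_on_lap: "C2_deriv f f' f'' \<Longrightarrow> continuous_on S (lap f'')"
  unfolding lap_def by (intro continuous_intros C2_deriv_cont2)

lemma integral_Green_identity:
  fixes f h :: "'a::euclidean_space \<Rightarrow> real"
  assumes f: "C2_deriv f f' f''" and h: "C2_deriv h h' h''"
    and supp: "\<And>x. x \<notin> cbox lo hi \<Longrightarrow> h x = 0"
  shows "integral (cbox lo hi) (\<lambda>x. h x * lap f'' x) = integral (cbox lo hi) (\<lambda>x. f x * lap h'' x)"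
proof -
  have h'0: "h' x v = 0" if "x \<notin> cbox lo hi" for x v
  proof -
    have "(h has_derivative (\<lambda>_. 0)) (at x)"
      by (rule has_derivative_transform_within_open[of "\<lambda>_. 0" _ _ _ "- cbox lo hi"])
         (use that supp in auto)
    then show ?thesis using C2_deriv_D1[OF h] has_derivative_unique by metis
  qed
  have "integral (cbox lo hi) (\<lambda>x. \<Sum>b\<in>Basis.
      (h' x b * f' x b + h x * f'' x b b) - (f' x b * h' x b + f x * h'' x b b)) = 0"
    by (rule integral_divergence_eq_0[where F = "\<lambda>b x. h x * f' x b - f x * h' x b"
        and F' = "\<lambda>b x v. (h' x v * f' x b + h x * f'' x b v) - (f' x v * h' x b + f x * h'' x b v)"])
       (rule has_derivative_eq_rhs[OF has_derivative_diff[OF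
           has_derivative_mult[OF C2_deriv_D1[OF h] C2_deriv_D2[OF f]]
           has_derivative_mult[OF C2_deriv_D1[OF f] C2_deriv_D2[OF h]]]],
        simp add: algebra_simps fun_eq_iff,
        intro continuous_intros C2_deriv_cont0[OF f] C2_deriv_cont0[OF h] C2_deriv_cont1[OF f]
          C2_deriv_cont1[OF h] C2_deriv_cont2[OF f] C2_deriv_cont2[OF h],
        simp add: supp h'0)
  also have "(\<lambda>x. \<Sum>b\<in>Basis. (h' x b * f' x b + h x * f'' x b b) - (f' x b * h' x b + f x * h'' x b b))
      = (\<lambda>x. h x * lap f'' x - f x * lap h'' x)"
    by (auto simp: lap_def sum_subtractf[symmetric] sum_distrib_left algebra_simps intro!: sum.cong)
  also have "integral (cbox lo hi) \<dots> =
      integral (cbox lo hi) (\<lambda>x. h x * lap f'' x) - integral (cbox lo hi) (\<lambda>x. f x * lap h'' x)"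
    by (intro integral_diff integrable_continuous continuous_intros
        C2_deriv_cont0[OF f] C2_deriv_cont0[OF h] continuous_on_lap[OF f] continuous_on_lap[OF h])
  finally show ?thesis by simp
qed

section \<open>The mean value inequality\<close>

text \<open>
  Powers of positive parts are the building blocks of all cutoff functions below: they are piecewise
  polynomial and as smooth as their exponent allows.
\<close>

lemma DERIV_max_0_power:
  "((\<lambda>s::real. max 0 s ^ Suc (Suc k)) has_real_derivative real (Suc (Suc k)) * max 0 s ^ Suc k) (at s)"
proof -
  consider "s < 0" | "s = 0" | "s > 0" by linarith
  then show ?thesis
  proof cases
    case 1
    have "((\<lambda>s::real. 0) has_real_derivative real (Suc (Suc k)) * max 0 s ^ Suc k) (at s)"
      using 1 by simp
    then show ?thesis
      by (rule has_field_derivative_transform_within_open[where S = "{..<0}"]) (use 1 in auto)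
  next
    case 2
    show ?thesis
      unfolding 2 CARAT_DERIV
    proof (intro exI[of _ "\<lambda>s. max 0 s ^ Suc k"] conjI)
      show "isCont (\<lambda>s::real. max 0 s ^ Suc k) 0" by (intro continuous_intros)
    qed (auto simp: max_def)
  next
    case 3
    have "((\<lambda>s::real. s ^ Suc (Suc k)) has_real_derivative real (Suc (Suc k)) * max 0 s ^ Suc k) (at s)"
      using DERIV_pow[of "Suc (Suc k)" s] 3 by (simp add: max_def)
    then show ?thesis
      by (rule has_field_derivative_transform_within_open[where S = "{0<..}"]) (use 3 in auto)
  qed
qed

lemma has_derivative_radial:
  fixes x :: "'a::euclidean_space"
  assumes "(w has_real_derivative w') (at (x \<bullet> x))"
  shows "((\<lambda>x. w (x \<bullet> x)) has_derivative (\<lambda>v. w' * (2 * (x \<bullet> v)))) (at x)"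
proof -
  have "((\<lambda>x. x \<bullet> x) has_derivative (\<lambda>v. 2 * (x \<bullet> v))) (at x)"
    by (rule has_derivative_eq_rhs[OF has_derivative_inner[OF has_derivative_ident has_derivative_ident]])
       (auto simp: inner_commute)
  from has_derivative_compose[OF this assms[unfolded has_field_derivative_def]] show ?thesis
    by simp
qed

definition bump :: "'a::euclidean_space \<Rightarrow> real" where
  "bump z = max 0 (1 - z \<bullet> z) ^ 2"

text \<open>
  Chosen so that its gradient is \<open>- bump z *\<^sub>R z\<close>; this is what turns the radial derivative of an average
  with weight \<open>bump\<close> into an average of the Laplacian.
\<close>

definition bump_potential :: "'a::euclidean_space \<Rightarrow> real" where
  "bump_potential z = max 0 (1 - z \<bullet> z) ^ 3 / 6"

lemma has_derivative_bump_potential: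
  "(bump_potential has_derivative (\<lambda>v. - bump z * (z \<bullet> v))) (at z)"
proof -
  have "((\<lambda>s::real. max 0 (1 - s) ^ 3 / 6) has_real_derivative - (max 0 (1 - z \<bullet> z) ^ 2) / 2) (at (z \<bullet> z))"
  proof -
    have "((\<lambda>s. 1 - s) has_real_derivative - 1) (at (z \<bullet> z))"
      by (auto intro!: derivative_eq_intros)
    from DERIV_chain2[where g = "\<lambda>s. 1 - s", OF DERIV_max_0_power[of 1 "1 - z \<bullet> z"] this]
    have "((\<lambda>s::real. max 0 (1 - s) ^ 3) has_real_derivative - 3 * max 0 (1 - z \<bullet> z) ^ 2) (at (z \<bullet> z))"
      by (simp add: numeral_2_eq_2 numeral_3_eq_3)
    from DERIV_cdivide[OF this, of 6] show ?thesis by simp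
  qed
  from has_derivative_radial[OF this] show ?thesis
    by (simp add: bump_potential_def[abs_def] bump_def)
qed

lemma continuous_on_bump [continuous_intros]: "continuous_on S bump"
  unfolding bump_def[abs_def] by (intro continuous_intros)

lemma continuous_on_bump_potential [continuous_intros]: "continuous_on S bump_potential"
  unfolding bump_potential_def[abs_def] by (intro continuous_intros) auto

lemma bump_nonneg: "0 \<le> bump z" and bump_potential_nonneg: "0 \<le> bump_potential z"
  by (auto simp: bump_def bump_potential_def)

lemma bump_le_1: "bump z \<le> 1"
  unfolding bump_def by (rule power_le_one) (auto simp: max_def)

lemma bump_outside:
  assumes "norm z \<ge> 1" shows "bump z = 0" "bump_potential z = 0"
proof -
  have "1 \<le> z \<bullet> z"
    using assms power_mono[of 1 "norm z" 2] by (simp add: dot_square_norm)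
  then show "bump z = 0" "bump_potential z = 0"
    by (auto simp: bump_def bump_potential_def)
qed

abbreviation unit_cube :: "'a::euclidean_space set" where
  "unit_cube \<equiv> cbox (- One) One"

lemma norm_ge_1_outside_unit_cube:
  fixes z :: "'a::euclidean_space"
  assumes "z \<notin> unit_cube" shows "norm z \<ge> 1"
proof (rule ccontr)
  assume "\<not> norm z \<ge> 1"
  then have "\<bar>z \<bullet> i\<bar> \<le> 1" if "i \<in> Basis" for i
    using Basis_le_norm[OF that, of z] by linarith
  then have "z \<in> unit_cube" by (auto simp: mem_box abs_le_iff minus_le_iff)
  then show False using assms by simp
qed

lemma integral_bump_pos: "0 < integral (unit_cube :: 'a::euclidean_space set) bump"
proof -
  have i: "(bump has_integral integral (unit_cube :: 'a set) bump) (unit_cube :: 'a set)"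
    by (intro integrable_integral integrable_continuous continuous_intros)
  have "0 \<le> integral (unit_cube :: 'a set) bump"
    using i bump_nonneg by (rule has_integral_nonneg)
  moreover have "integral (unit_cube :: 'a set) bump \<noteq> 0"
  proof
    assume "integral (unit_cube :: 'a set) bump = 0"
    with i have "(bump has_integral 0) (unit_cube :: 'a set)" by simp
    from has_integral_0_cbox_imp_0[OF _ _ this, of 0] have "bump (0::'a) = 0"
      by (auto intro!: continuous_intros simp: bump_nonneg box_ne_empty mem_box)
    then show False by (simp add: bump_def)
  qed
  ultimately show ?thesis by linarith
qed

lemma continuous_on_affine:
  fixes g :: "'a::real_normed_vector \<Rightarrow> 'b::topological_space"
  assumes "continuous_on UNIV g"
  shows "continuous_on S (\<lambda>z. g (y + t *\<^sub>R z))"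
  by (intro continuous_on_compose2[OF assms] continuous_intros) auto

text \<open>
  Let \<open>I t\<close> be the average of \<open>f (y + t z)\<close> with weight \<open>bump z\<close>. Its derivative is the average of
  \<open>z \<bullet> \<nabla>f (y + t z)\<close>, which by the divergence theorem equals \<open>t\<close> times the average of the
  Laplacian with weight \<open>bump_potential\<close>. A lower bound on the Laplacian therefore bounds how much the
  average over the ball of radius \<open>r\<close> can fall below the value at the centre.
\<close>

lemma mean_value_inequality:
  fixes f :: "'a::euclidean_space \<Rightarrow> real"
  assumes f: "C2_deriv f f' f''"
    and r: "0 < r" and K: "0 \<le> K"
    and sub: "\<And>x. x \<in> ball y r \<Longrightarrow> - K \<le> lap f'' x"
  shows "f y * integral (unit_cube :: 'a set) bump
    \<le> integral unit_cube (\<lambda>z. bump z * f (y + r *\<^sub>R z)) + K * r\<^sup>2 * integral (unit_cube :: 'a set) bump_potential"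
proof -
  let ?m = "integral (unit_cube :: 'a set) bump_potential"
  define I where "I t = integral unit_cube (\<lambda>z. bump z * f (y + t *\<^sub>R z))" for t
  define J where "J t = integral unit_cube (\<lambda>z. bump z * (\<Sum>b\<in>Basis. (z \<bullet> b) * f' (y + t *\<^sub>R z) b))" for t
  have c0: "continuous_on S (\<lambda>z. f (y + t *\<^sub>R z))" and c1: "continuous_on S (\<lambda>z. f' (y + t *\<^sub>R z) v)"
    and c2: "continuous_on S (\<lambda>z. f'' (y + t *\<^sub>R z) u v)" for S t u v
    using continuous_on_affine[OF C2_deriv_cont0[OF f]] continuous_on_affine[OF C2_deriv_cont1[OF f]]
      continuous_on_affine[OF C2_deriv_cont2[OF f]] by auto
  have m: "0 \<le> ?m"
    by (rule integral_nonneg) (auto intro!: integrable_continuous continuous_intros simp: bump_potential_nonneg)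
  have I': "(I has_vector_derivative J t) (at t within {0..r})" if "t \<in> {0..r}" for t
    unfolding I_def J_def
  proof (rule leibniz_rule_vector_derivative[OF _ _ _ that])
    show "((\<lambda>t. bump z * f (y + t *\<^sub>R z)) has_vector_derivative
        bump z * (\<Sum>b\<in>Basis. (z \<bullet> b) * f' (y + t *\<^sub>R z) b)) (at t within {0..r})" for t z
    proof -
      have "((\<lambda>t. f (y + t *\<^sub>R z)) has_vector_derivative f' (y + t *\<^sub>R z) z) (at t within {0..r})"
        by (rule has_derivative_along_line[OF C2_deriv_D1[OF f]])
      from bounded_linear.has_vector_derivative[OF bounded_linear_mult_right this]
      show ?thesis
        using linear_Basis_expand[OF C2_deriv_linear1[OF f], of "y + t *\<^sub>R z" z] by simp
    qed
    show "continuous_on ({0..r} \<times> unit_cube) (\<lambda>(t, z). bump z * (\<Sum>b\<in>Basis. (z \<bullet> b) * f' (y + t *\<^sub>R z) b))"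
      unfolding split_beta
      by (intro continuous_intros continuous_on_compose2[OF continuous_on_bump[of UNIV]]
          continuous_on_compose2[OF C2_deriv_cont1[OF f, of UNIV]]) auto
  qed (auto intro!: integrable_continuous continuous_intros c0)
  \<comment> \<open>The divergence theorem for the field \<open>bump_potential z *\<^sub>R \<nabla>f (y + t z)\<close>.\<close>
  have J: "J t = t * integral unit_cube (\<lambda>z. bump_potential z * lap f'' (y + t *\<^sub>R z))" for t
  proof -
    have d: "((\<lambda>z. f' (y + t *\<^sub>R z) b) has_derivative (\<lambda>v. f'' (y + t *\<^sub>R z) b (t *\<^sub>R v))) (at z)" for b z
      by (rule has_derivative_compose[OF _ C2_deriv_D2[OF f]]) (auto intro!: derivative_eq_intros)
    have "integral unit_cube (\<lambda>z. \<Sum>b\<in>Basis. bump_potential z * f'' (y + t *\<^sub>R z) b (t *\<^sub>R b)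
        + - bump z * (z \<bullet> b) * f' (y + t *\<^sub>R z) b) = 0"
      by (rule integral_divergence_eq_0[where
            F' = "\<lambda>b z v. bump_potential z * f'' (y + t *\<^sub>R z) b (t *\<^sub>R v) + - bump z * (z \<bullet> v) * f' (y + t *\<^sub>R z) b",
            OF has_derivative_mult[OF has_derivative_bump_potential d]])
         (auto intro!: continuous_intros c1 c2 simp: bump_outside norm_ge_1_outside_unit_cube)
    also have "(\<lambda>z. \<Sum>b\<in>Basis. bump_potential z * f'' (y + t *\<^sub>R z) b (t *\<^sub>R b) + - bump z * (z \<bullet> b) * f' (y + t *\<^sub>R z) b)
      = (\<lambda>z. t * (bump_potential z * lap f'' (y + t *\<^sub>R z)) - bump z * (\<Sum>b\<in>Basis. (z \<bullet> b) * f' (y + t *\<^sub>R z) b))"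
      by (simp add: fun_eq_iff lap_def linear_cmul[OF C2_deriv_linear2[OF f]] sum.distrib sum_negf
          sum_distrib_left algebra_simps sum_subtractf)
    also have "integral unit_cube \<dots> = t * integral unit_cube (\<lambda>z. bump_potential z * lap f'' (y + t *\<^sub>R z)) - J t"
      unfolding J_def integral_mult_right[symmetric]
      by (intro integral_diff integrable_continuous continuous_intros c1) (auto simp: lap_def intro!: continuous_intros c2)
    finally show ?thesis by simp
  qed
  have J_ge: "J t \<ge> - (2 * t * K * ?m)" if t: "t \<in> {0<..<r}" for t
  proof -
    have "- (K * ?m) = integral unit_cube (\<lambda>z::'a. - K * bump_potential z)" by simp
    also have "\<dots> \<le> integral unit_cube (\<lambda>z. bump_potential z * lap f'' (y + t *\<^sub>R z))"
    proof (rule integral_le)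
      fix z :: 'a
      show "- K * bump_potential z \<le> bump_potential z * lap f'' (y + t *\<^sub>R z)"
      proof (cases "norm z < 1")
        case True
        then have "y + t *\<^sub>R z \<in> ball y r"
          using t mult_strict_mono[of t r "norm z" 1] by (simp add: dist_norm)
        from mult_left_mono[OF sub[OF this] bump_potential_nonneg[of z]] show ?thesis
          by (simp add: mult.commute)
      qed (simp add: bump_outside)
    qed (auto intro!: integrable_continuous continuous_intros c2 simp: lap_def)
    finally have "t * - (K * ?m) \<le> J t" unfolding J using t by (intro mult_left_mono) auto
    moreover have "0 \<le> t * (K * ?m)" using t K m by simp
    ultimately show ?thesis by (simp add: algebra_simps)
  qed
  have "\<exists>t\<in>{0<..<r}. (I r + K * r\<^sup>2 * ?m) - (I 0 + K * 0\<^sup>2 * ?m) = (r - 0) * (J t + 2 * t * K * ?m)"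
  proof (rule mvt_simple[OF r])
    fix t assume "0 \<le> t" "t \<le> r"
    then have "(I has_real_derivative J t) (at t within {0..r})"
      using I'[of t] by (simp add: has_real_derivative_iff_has_vector_derivative)
    then have "((\<lambda>t. I t + K * t\<^sup>2 * ?m) has_real_derivative (J t + 2 * t * K * ?m)) (at t within {0..r})"
      by (auto intro!: derivative_eq_intros)
    then show "((\<lambda>t. I t + K * t\<^sup>2 * ?m) has_derivative (\<lambda>h. h * (J t + 2 * t * K * ?m))) (at t within {0..r})"
      unfolding has_field_derivative_def by (rule has_derivative_eq_rhs) (simp add: fun_eq_iff)
  qed
  then have "0 \<le> (I r + K * r\<^sup>2 * ?m) - I 0"
    using J_ge r by force
  moreover have "I 0 = f y * integral (unit_cube :: 'a set) bump"
    by (simp add: I_def)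
  moreover have "I r = integral unit_cube (\<lambda>z. bump z * f (y + r *\<^sub>R z))"
    by (simp add: I_def)
  ultimately show ?thesis by linarith
qed

section \<open>Small scale invariant integrals force decay\<close>

abbreviation cube :: "'a::euclidean_space \<Rightarrow> real \<Rightarrow> 'a set" where
  "cube y r \<equiv> cbox (y - r *\<^sub>R One) (y + r *\<^sub>R One)"

lemma mem_cube: "z \<in> cube y r \<longleftrightarrow> (\<forall>b\<in>Basis. \<bar>(z - y) \<bullet> b\<bar> \<le> r)"
  unfolding mem_box by (auto simp: inner_simps abs_le_iff algebra_simps)

lemma norm_diff_le_in_cube:
  fixes z y :: "'a::euclidean_space"
  assumes "z \<in> cube y r"
  shows "norm (z - y) \<le> real DIM('a) * r"
proof -
  have "norm (z - y) \<le> (\<Sum>b\<in>Basis. \<bar>(z - y) \<bullet> b\<bar>)" by (rule norm_le_l1)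
  also have "\<dots> \<le> (\<Sum>b\<in>(Basis::'a set). r)" using assms by (intro sum_mono) (simp only: mem_cube)
  finally show ?thesis by simp
qed

lemma in_cube_0:
  assumes "norm x \<le> r" shows "x \<in> cube 0 r"
  unfolding mem_cube using assms by (metis Basis_le_norm diff_zero order_trans)

lemma measure_cube:
  fixes y :: "'a::euclidean_space"
  assumes "0 \<le> r"
  shows "measure lborel (cube y r) = (2 * r) ^ DIM('a)"
proof -
  have "measure lborel (cube y r) = (\<Prod>b\<in>Basis. (y + r *\<^sub>R One) \<bullet> b - (y - r *\<^sub>R One) \<bullet> b)"
    using assms by (intro content_cbox) (simp add: inner_simps)
  also have "\<dots> = (\<Prod>b\<in>(Basis::'a set). 2 * r)"
    by (intro prod.cong refl) (simp add: inner_simps)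
  finally show ?thesis by simp
qed

lemma integral_rescale_cube:
  fixes g :: "'a::euclidean_space \<Rightarrow> real"
  assumes g: "continuous_on UNIV g" and r: "0 < r"
  shows "integral unit_cube (\<lambda>z. g (y + r *\<^sub>R z)) = integral (cube y r) g / r ^ DIM('a)"
proof -
  have "(g has_integral integral (cube y r) g) (cube y r)"
    by (intro integrable_integral integrable_continuous continuous_on_subset[OF g]) auto
  from has_integral_affinity[OF this, of r y]
  have "((\<lambda>z. g (r *\<^sub>R z + y)) has_integral (1 / r ^ DIM('a)) *\<^sub>R integral (cube y r) g)
      ((\<lambda>x. (1 / r) *\<^sub>R x + - ((1 / r) *\<^sub>R y)) ` cube y r)"
    using r by simp
  also have "(\<lambda>x. (1 / r) *\<^sub>R x + - ((1 / r) *\<^sub>R y)) ` cube y r = unit_cube"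
  proof -
    have "y \<in> cube y r" using r by (simp add: mem_cube)
    then have "cube y r \<noteq> {}" by blast
    then show ?thesis
      unfolding image_affinity_cbox using r by (simp add: scaleR_add_right scaleR_diff_right)
  qed
  finally show ?thesis by (simp add: integral_unique add.commute)
qed

lemma continuous_on_powr_const:
  fixes f :: "'a::topological_space \<Rightarrow> real"
  assumes "continuous_on S f" "\<And>x. 0 \<le> f x" "0 < a"
  shows "continuous_on S (\<lambda>x. f x powr a)"
  using assms by (intro continuous_on_powr') auto

text \<open>
  This replaces Jensen's inequality when a mean of \<open>t\<close> is to be estimated by a mean of \<open>t powr a\<close>. It
  covers the exponents \<open>a < 1\<close> as well, where convexity is not available, because \<open>t\<close> is also bounded by a
  multiple of the reference value \<open>M\<close>.
\<close>

lemma le_quarter_plus_power: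
  fixes t M \<Lambda> a :: real
  assumes "0 < M" "0 \<le> t" "t \<le> \<Lambda> * M" "0 < a"
  shows "t \<le> M / 4 + (\<Lambda> * 4 powr a * M powr (1 - a)) * t powr a"
proof (cases "t \<le> M / 4")
  case True
  have "0 \<le> \<Lambda> * M" using assms by linarith
  then have "0 \<le> \<Lambda>" using assms by (simp add: zero_le_mult_iff)
  then have "0 \<le> (\<Lambda> * 4 powr a * M powr (1 - a)) * t powr a" by simp
  with True show ?thesis by linarith
next
  case False
  then have "1 \<le> (4 * t / M) powr a"
    using assms by (intro ge_one_powr_ge_zero) (auto simp: field_simps)
  moreover have "0 \<le> \<Lambda> * M" using assms by linarith
  ultimately have "\<Lambda> * M * 1 \<le> \<Lambda> * M * (4 * t / M) powr a"
    by (intro mult_left_mono)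
  also have "\<dots> = (\<Lambda> * 4 powr a * M powr (1 - a)) * t powr a"
    using assms by (simp add: powr_divide powr_mult powr_diff)
  finally have "\<Lambda> * M \<le> (\<Lambda> * 4 powr a * M powr (1 - a)) * t powr a" by simp
  then show ?thesis using assms by linarith
qed

text \<open>
  The selection of a good point. If the conclusion fails at \<open>y\<close>, let \<open>x\<^sub>0\<close> maximise
  \<open>(\<rho> - dist x y)\<^sup>2 * f x powr s\<close> and let \<open>M = f x\<^sub>0\<close>. On a ball around \<open>x\<^sub>0\<close> whose radius \<open>r\<close> is a small
  multiple of the intrinsic length \<open>M powr (- s / 2)\<close>, the function \<open>f\<close> is at most a constant times \<open>M\<close>.
  The Laplacian is then at least a negative constant times \<open>M / r\<^sup>2\<close>, with a small constant, so the mean value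
  inequality bounds \<open>M\<close>, up to a quarter of \<open>M\<close>, by the average of \<open>f\<close> over the ball. This average is
  at most \<open>M / 4\<close> plus a multiple of \<open>M * \<epsilon>\<close>, which is absurd for small \<open>\<epsilon>\<close>. Everything is invariant under the scaling that preserves \<open>r\<^sup>2 * M powr s\<close>.
\<close>

lemma small_integral_imp_small_value:
  fixes s K \<delta> :: real
  assumes s: "0 < s" and K: "0 \<le> K" and \<delta>: "0 < \<delta>"
  shows "\<exists>\<epsilon>>0. \<forall>(f::'a::euclidean_space \<Rightarrow> real) f' f'' y \<rho>.
    C2_deriv f f' f'' \<longrightarrow> (\<forall>x. 0 \<le> f x) \<longrightarrow> (\<forall>x. - K * f x powr (1 + s) \<le> lap f'' x) \<longrightarrow> 0 < \<rho> \<longrightarrow>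
    integral (cube y \<rho>) (\<lambda>x. f x powr (DIM('a) * s / 2)) \<le> \<epsilon> \<longrightarrow> \<rho>\<^sup>2 * f y powr s \<le> \<delta>"
proof -
  define a where "a = DIM('a) * s / 2"
  have a: "0 < a" using s by (simp add: a_def)
  define \<Lambda> :: real where "\<Lambda> = 4 powr (1 / s)"
  have \<Lambda>: "0 < \<Lambda>" "\<Lambda> powr s = 4" using s by (auto simp: \<Lambda>_def powr_powr)
  let ?m0 = "integral (unit_cube :: 'a set) bump"
  let ?m1 = "integral (unit_cube :: 'a set) bump_potential"
  have m0: "0 < ?m0" by (rule integral_bump_pos)
  have m1: "0 \<le> ?m1"
    by (rule integral_nonneg) (auto intro!: integrable_continuous continuous_intros simp: bump_potential_nonneg)
  define K1 where "K1 = K * \<Lambda> powr (1 + s)"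
  have K1: "0 \<le> K1" using K by (simp add: K1_def)
  \<comment> \<open>The ratio of the radius to the intrinsic length: the first bound keeps the ball inside
    \<open>cball y \<rho>\<close>, the second makes the error term of the mean value inequality at most a quarter.\<close>
  define \<theta> where "\<theta> = min (sqrt \<delta> / 2) (sqrt (?m0 / (4 * (K1 * ?m1 + 1))))"
  have pos: "0 < K1 * ?m1 + 1" using K1 m1 by (simp add: add_nonneg_pos)
  have \<theta>: "0 < \<theta>" using \<delta> m0 pos by (simp add: \<theta>_def)
  have \<theta>1: "4 * \<theta>\<^sup>2 \<le> \<delta>"
  proof -
    have "\<theta>\<^sup>2 \<le> (sqrt \<delta> / 2)\<^sup>2" using \<theta> by (intro power_mono) (auto simp: \<theta>_def)
    then show ?thesis using \<delta> by (simp add: power_divide)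
  qed
  have \<theta>2: "K1 * \<theta>\<^sup>2 * ?m1 \<le> ?m0 / 4"
  proof -
    have "\<theta>\<^sup>2 \<le> (sqrt (?m0 / (4 * (K1 * ?m1 + 1))))\<^sup>2" using \<theta> by (intro power_mono) (auto simp: \<theta>_def)
    also have "\<dots> = ?m0 / (4 * (K1 * ?m1 + 1))" using m0 pos by (intro real_sqrt_pow2) auto
    finally have "(K1 * ?m1 + 1) * \<theta>\<^sup>2 \<le> ?m0 / 4" using pos by (simp add: field_simps)
    then have "K1 * \<theta>\<^sup>2 * ?m1 + \<theta>\<^sup>2 \<le> ?m0 / 4" by (simp add: algebra_simps)
    then show ?thesis using zero_le_power2[of \<theta>] by linarith
  qed
  define C where "C = \<Lambda> * 4 powr a"
  have C: "0 < C" using \<Lambda> by (simp add: C_def)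
  define \<epsilon> where "\<epsilon> = ?m0 * \<theta> ^ DIM('a) / (8 * C)"
  have \<epsilon>: "0 < \<epsilon>" using m0 \<theta> C by (simp add: \<epsilon>_def)
  have "\<rho>\<^sup>2 * f y powr s \<le> \<delta>"
    if f: "C2_deriv f f' f''" and nn: "\<And>x. 0 \<le> f x" and sub: "\<And>x. - K * f x powr (1 + s) \<le> lap f'' x"
      and \<rho>: "0 < \<rho>" and small: "integral (cube y \<rho>) (\<lambda>x. f x powr a) \<le> \<epsilon>"
    for f :: "'a \<Rightarrow> real" and f' f'' y \<rho>
  proof (rule ccontr)
    assume big: "\<not> \<rho>\<^sup>2 * f y powr s \<le> \<delta>"
    have cp: "continuous_on S (\<lambda>x. f x powr b)" if "0 < b" for S b
      using that nn by (intro continuous_on_powr_const C2_deriv_cont0[OF f]) auto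
    define H where "H x = (\<rho> - dist x y)\<^sup>2 * f x powr s" for x
    have "continuous_on (cball y \<rho>) H"
      unfolding H_def by (intro continuous_intros cp s)
    then obtain x0 where x0: "x0 \<in> cball y \<rho>" and max: "\<And>x. x \<in> cball y \<rho> \<Longrightarrow> H x \<le> H x0"
      using continuous_attains_sup[of "cball y \<rho>" H] \<rho> by auto
    define M where "M = f x0"
    define d where "d = \<rho> - dist x0 y"
    have H0: "\<delta> < d\<^sup>2 * M powr s"
      using big max[of y] \<rho> by (simp add: H_def M_def d_def)
    have "M \<noteq> 0" "d \<noteq> 0" using H0 \<delta> s by auto
    then have M: "0 < M" and d: "0 < d"
      using nn[of x0] x0 by (auto simp: M_def d_def dist_commute)
    \<comment> \<open>The natural length scale at the selected point; the ball of radius \<open>r\<close> stays well inside.\<close>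
    define r where "r = \<theta> * M powr (- s / 2)"
    have r: "0 < r" using \<theta> M by (simp add: r_def)
    have "(M powr (- s / 2))\<^sup>2 = M powr (- s)"
      using M by (simp add: powr_power)
    then have r2: "r\<^sup>2 * M powr s = \<theta>\<^sup>2"
      using M by (simp add: r_def power_mult_distrib mult.assoc powr_add[symmetric])
    have "(2 * r)\<^sup>2 * M powr s < d\<^sup>2 * M powr s"
      using r2 \<theta>1 H0 by (simp add: power_mult_distrib mult.assoc)
    then have "(2 * r)\<^sup>2 < d\<^sup>2" using M by simp
    then have rd: "2 * r < d" using d by (meson less_imp_le power_less_imp_less_base)
    have upper: "f x \<le> \<Lambda> * M" if x: "x \<in> ball x0 r" for x
    proof -
      have "dist x y \<le> dist x0 y + d / 2"
        using x rd dist_triangle[of x y x0] by (simp add: dist_commute)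
      then have *: "d / 2 \<le> \<rho> - dist x y" unfolding d_def by argo
      then have "x \<in> cball y \<rho>" using d by (simp add: dist_commute)
      have "(d / 2)\<^sup>2 * f x powr s \<le> (\<rho> - dist x y)\<^sup>2 * f x powr s"
        using * d by (intro mult_right_mono power_mono) auto
      also have "\<dots> \<le> d\<^sup>2 * M powr s"
        using max[OF \<open>x \<in> cball y \<rho>\<close>] by (simp add: H_def d_def M_def)
      finally have "f x powr s \<le> 4 * M powr s" using d by (simp add: field_simps)
      also have "\<dots> = (\<Lambda> * M) powr s" using \<Lambda> M by (simp add: powr_mult)
      finally show ?thesis
        using s \<Lambda> M powr_less_mono2[of s "\<Lambda> * M" "f x"] by (meson less_imp_le mult_pos_pos not_less)
    qed
    have lower: "- (K1 * M powr (1 + s)) \<le> lap f'' x" if "x \<in> ball x0 r" for x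
    proof -
      have "K * f x powr (1 + s) \<le> K * (\<Lambda> * M) powr (1 + s)"
        using K s nn upper[OF that] by (intro mult_left_mono powr_mono2) auto
      also have "\<dots> = K1 * M powr (1 + s)" using \<Lambda> M by (simp add: K1_def powr_mult)
      finally show ?thesis using sub[of x] by simp
    qed
    have "M * ?m0 \<le> integral unit_cube (\<lambda>z. bump z * f (x0 + r *\<^sub>R z)) + (K1 * M powr (1 + s)) * r\<^sup>2 * ?m1"
      unfolding M_def
      by (rule mean_value_inequality[OF f r _ lower[unfolded M_def]]) (use K1 M in auto)
    also have "(K1 * M powr (1 + s)) * r\<^sup>2 * ?m1 = M * (K1 * \<theta>\<^sup>2 * ?m1)"
      using M by (simp add: powr_add r2[symmetric])
    also have "\<dots> \<le> M * (?m0 / 4)" using M \<theta>2 by (intro mult_left_mono) auto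
    also have "integral unit_cube (\<lambda>z. bump z * f (x0 + r *\<^sub>R z)) \<le>
       integral unit_cube (\<lambda>z. M / 4 * bump z + (C * M powr (1 - a)) * f (x0 + r *\<^sub>R z) powr a)"
    proof (rule integral_le)
      show "(\<lambda>z. bump z * f (x0 + r *\<^sub>R z)) integrable_on unit_cube"
        "(\<lambda>z. M / 4 * bump z + (C * M powr (1 - a)) * f (x0 + r *\<^sub>R z) powr a) integrable_on unit_cube"
        by (intro integrable_continuous continuous_intros
            continuous_on_compose2[OF C2_deriv_cont0[OF f, of UNIV]] continuous_on_compose2[OF cp[OF a, of UNIV]]; simp)+
      fix z :: 'a
      show "bump z * f (x0 + r *\<^sub>R z) \<le> M / 4 * bump z + (C * M powr (1 - a)) * f (x0 + r *\<^sub>R z) powr a"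
      proof (cases "norm z < 1")
        case True
        then have "x0 + r *\<^sub>R z \<in> ball x0 r" using r by (simp add: dist_norm)
        then have *: "f (x0 + r *\<^sub>R z) \<le> M / 4 + (C * M powr (1 - a)) * f (x0 + r *\<^sub>R z) powr a"
          unfolding C_def using le_quarter_plus_power[OF M nn upper a] by simp
        have "bump z * f (x0 + r *\<^sub>R z) \<le> bump z * (M / 4) + bump z * ((C * M powr (1 - a)) * f (x0 + r *\<^sub>R z) powr a)"
          using mult_left_mono[OF * bump_nonneg[of z]] by (simp add: algebra_simps)
        also have "bump z * ((C * M powr (1 - a)) * f (x0 + r *\<^sub>R z) powr a) \<le> (C * M powr (1 - a)) * f (x0 + r *\<^sub>R z) powr a"
          using C by (intro mult_left_le_one_le) (auto simp: bump_nonneg bump_le_1)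
        finally show ?thesis by (simp add: mult.commute)
      qed (use C in \<open>simp add: bump_outside\<close>)
    qed
    also have "\<dots> = M / 4 * ?m0 + (C * M powr (1 - a)) * integral unit_cube (\<lambda>z. f (x0 + r *\<^sub>R z) powr a)"
      by (subst integral_add)
         (auto intro!: integrable_continuous continuous_intros continuous_on_compose2[OF cp[OF a, of UNIV]])
    also have "integral unit_cube (\<lambda>z. f (x0 + r *\<^sub>R z) powr a) = integral (cube x0 r) (\<lambda>x. f x powr a) / r ^ DIM('a)"
      by (rule integral_rescale_cube[OF cp[OF a] r])
    also have "integral (cube x0 r) (\<lambda>x. f x powr a) \<le> \<epsilon>"
    proof -
      have "cube x0 r \<subseteq> cube y \<rho>"
      proof
        fix z assume z: "z \<in> cube x0 r"
        have "\<bar>(z - y) \<bullet> b\<bar> \<le> \<rho>" if "b \<in> Basis" for b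
        proof -
          have "\<bar>(z - x0) \<bullet> b\<bar> \<le> r" using z that by (simp add: mem_cube)
          moreover have "\<bar>(x0 - y) \<bullet> b\<bar> \<le> dist x0 y" using Basis_le_norm[OF that] by (simp add: dist_norm)
          moreover have "(z - y) \<bullet> b = (z - x0) \<bullet> b + (x0 - y) \<bullet> b" by (simp add: inner_simps)
          ultimately show ?thesis using rd r by (simp add: d_def)
        qed
        then show "z \<in> cube y \<rho>" by (simp add: mem_cube)
      qed
      then have "integral (cube x0 r) (\<lambda>x. f x powr a) \<le> integral (cube y \<rho>) (\<lambda>x. f x powr a)"
        by (intro integral_subset_le integrable_continuous cp a) auto
      with small show ?thesis by linarith
    qed
    also have "(C * M powr (1 - a)) * (\<epsilon> / r ^ DIM('a)) = M * (?m0 / 8)"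
    proof -
      have "r ^ DIM('a) = \<theta> ^ DIM('a) * M powr (- a)"
        using M by (simp add: r_def power_mult_distrib powr_power a_def mult.commute)
      moreover have "M powr (1 - a) = M * M powr (- a)"
        using M by (simp add: powr_diff powr_minus divide_inverse)
      ultimately show ?thesis using M C \<theta> by (simp add: \<epsilon>_def field_simps)
    qed
    finally have "M * ?m0 \<le> M / 4 * ?m0 + M * (?m0 / 8) + M * (?m0 / 4)"
      using C M r by (simp add: divide_right_mono mult_left_mono)
    moreover have "0 < M * ?m0" using M m0 by simp
    ultimately show False by simp
  qed
  with \<epsilon> show ?thesis unfolding a_def by blast
qed

text \<open>
  Apply the previous lemma with \<open>\<rho>\<close> proportional to \<open>norm x\<close>: the cube around \<open>x\<close> then stays away from any given
  bounded set once \<open>x\<close> is large, so the integral over it is part of a small tail.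
\<close>

lemma scale_invariant_decay:
  fixes f :: "'a::euclidean_space \<Rightarrow> real" and s K \<delta> :: real
  assumes s: "0 < s" and K: "0 \<le> K" and \<delta>: "0 < \<delta>"
    and f: "C2_deriv f f' f''" and nn: "\<And>x. 0 \<le> f x"
    and sub: "\<And>x. - K * f x powr (1 + s) \<le> lap f'' x"
    and int: "(\<lambda>x. f x powr (DIM('a) * s / 2)) integrable_on UNIV"
  shows "\<exists>R>0. \<forall>x. R \<le> norm x \<longrightarrow> (norm x)\<^sup>2 * f x powr s \<le> \<delta>"
proof -
  let ?n = "real DIM('a)"
  let ?g = "\<lambda>x. f x powr (?n * s / 2)"
  have n: "1 \<le> ?n" using DIM_positive[where 'a='a] by linarith
  have "0 < \<delta> / (4 * ?n\<^sup>2)" using \<delta> n by simp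
  from small_integral_imp_small_value[OF s K this, where 'a='a]
  obtain \<epsilon> where \<epsilon>: "0 < \<epsilon>" and
    small: "\<And>y \<rho>. 0 < \<rho> \<Longrightarrow> integral (cube y \<rho>) ?g \<le> \<epsilon> \<Longrightarrow> \<rho>\<^sup>2 * f y powr s \<le> \<delta> / (4 * ?n\<^sup>2)"
    using f nn sub by blast
  have cg: "continuous_on S ?g" for S
    using s n nn by (intro continuous_on_powr_const C2_deriv_cont0[OF f]) auto
  have "(?g has_integral integral UNIV ?g) UNIV" using int by (rule integrable_integral)
  then obtain B where B: "0 < B" and
    tail: "\<And>a b. ball 0 B \<subseteq> cbox a b \<Longrightarrow> \<bar>integral (cbox a b) ?g - integral UNIV ?g\<bar> < \<epsilon>"
    unfolding has_integral_alt' using \<epsilon> by (auto simp: real_norm_def)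
  have "(norm x)\<^sup>2 * f x powr s \<le> \<delta>" if x: "2 * ?n * B + 1 \<le> norm x" for x
  proof -
    define \<rho> where "\<rho> = norm x / (2 * ?n)"
    have "0 < norm x" using x B n by (smt (verit) mult_nonneg_nonneg)
    then have \<rho>: "0 < \<rho>" using n by (simp add: \<rho>_def)
    have disj: "cube 0 B \<inter> cube x \<rho> = {}"
    proof (rule equals0I)
      fix z assume z: "z \<in> cube 0 B \<inter> cube x \<rho>"
      have "norm z \<le> ?n * B" using z norm_diff_le_in_cube[of z 0 B] by simp
      moreover have "norm (z - x) \<le> norm x / 2" using z norm_diff_le_in_cube[of z x \<rho>] n by (simp add: \<rho>_def)
      moreover have "norm x \<le> norm z + norm (z - x)" by (metis norm_minus_commute norm_triangle_sub)
      ultimately show False using x by linarith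
    qed
    have "ball 0 B \<subseteq> cube 0 B"
      by (intro subsetI in_cube_0) simp
    from tail[OF this] have "integral UNIV ?g - \<epsilon> < integral (cube 0 B) ?g" by linarith
    moreover have "integral (cube 0 B) ?g + integral (cube x \<rho>) ?g = integral (cube 0 B \<union> cube x \<rho>) ?g"
      by (rule integral_Un[symmetric]) (use disj in \<open>auto intro!: integrable_continuous cg\<close>)
    moreover have "integral (cube 0 B \<union> cube x \<rho>) ?g \<le> integral UNIV ?g"
      by (rule integral_subset_le)
        (use disj in \<open>auto intro!: integrable_Un integrable_continuous cg int\<close>)
    ultimately have "integral (cube x \<rho>) ?g \<le> \<epsilon>" by linarith
    from small[OF \<rho> this] show ?thesis
      using n by (simp add: \<rho>_def power_divide power_mult_distrib field_simps)
  qed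
  moreover have "0 < 2 * ?n * B + 1" using B n by (simp add: add_pos_pos)
  ultimately show ?thesis by blast
qed

section \<open>Comparison in exterior domains\<close>

lemma local_max_derivative_conditions:
  fixes g :: "real \<Rightarrow> real"
  assumes d: "0 < d"
    and g: "\<And>t. \<bar>t\<bar> < d \<Longrightarrow> (g has_real_derivative g' t) (at t)"
    and g': "(g' has_real_derivative g'') (at 0)"
    and max: "\<And>t. \<bar>t\<bar> < d \<Longrightarrow> g t \<le> g 0"
  shows "g' 0 = 0" "g'' \<le> 0"
proof -
  show z: "g' 0 = 0"
    by (rule DERIV_local_max[OF g[of 0] d]) (use max d in auto)
  show "g'' \<le> 0"
  proof (rule ccontr)
    assume "\<not> g'' \<le> 0"
    then obtain e where e: "0 < e" "\<And>h. 0 < h \<Longrightarrow> h < e \<Longrightarrow> g' 0 < g' h"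
      using DERIV_pos_inc_right[OF g'] by auto
    define h where "h = min d e / 2"
    have h: "0 < h" "h < d" "h < e" using d e(1) by (auto simp: h_def)
    have "g 0 < g h"
    proof (rule DERIV_pos_imp_increasing_open[OF h(1)])
      fix t assume "0 < t" "t < h"
      then show "\<exists>y. (g has_real_derivative y) (at t) \<and> 0 < y"
        using g[of t] e(2)[of t] h z by auto
    next
      show "continuous_on {0..h} g"
        by (intro DERIV_continuous_on[where D = g'] DERIV_subset[OF g]) (use h in auto)
    qed
    then show False using max[of h] h by auto
  qed
qed

text \<open>
  The conditions that \<open>f\<close> minus a radial function satisfies at an interior maximum: the gradients agree and
  the Laplacian of \<open>f\<close> is at most that of the radial function \<open>W (x \<bullet> x)\<close>. Only second derivatives
  along the coordinate lines are compared.
\<close>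

lemma touching_radial_function:
  fixes f :: "'a::euclidean_space \<Rightarrow> real" and W W' W'' :: "real \<Rightarrow> real"
  assumes f: "C2_deriv f f' f''"
    and W: "\<And>s. 0 < s \<Longrightarrow> (W has_real_derivative W' s) (at s)"
    and W': "\<And>s. 0 < s \<Longrightarrow> (W' has_real_derivative W'' s) (at s)"
    and \<delta>: "0 < \<delta>" "\<delta> \<le> norm x"
    and touch: "\<And>z. z \<in> ball x \<delta> \<Longrightarrow> f z - W (z \<bullet> z) \<le> f x - W (x \<bullet> x)"
  shows "(\<Sum>b\<in>Basis. (f' x b)\<^sup>2) = 4 * (W' (x \<bullet> x))\<^sup>2 * (x \<bullet> x)"
    and "lap f'' x \<le> 2 * real DIM('a) * W' (x \<bullet> x) + 4 * (x \<bullet> x) * W'' (x \<bullet> x)"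
proof -
  let ?S = "x \<bullet> x"
  have *: "f' x b = 2 * W' ?S * (x \<bullet> b) \<and> f'' x b b \<le> 2 * W' ?S + 4 * W'' ?S * (x \<bullet> b)\<^sup>2"
    if b: "b \<in> Basis" for b
  proof -
    define p where "p t = (x + t *\<^sub>R b) \<bullet> (x + t *\<^sub>R b)" for t :: real
    define g where "g t = f (x + t *\<^sub>R b) - W (p t)" for t :: real
    define g' where "g' t = f' (x + t *\<^sub>R b) b - W' (p t) * (2 * (x \<bullet> b) + 2 * t)" for t :: real
    have p: "(p has_real_derivative (2 * (x \<bullet> b) + 2 * t)) (at t)" for t
    proof -
      have "p = (\<lambda>t. x \<bullet> x + 2 * t * (x \<bullet> b) + t\<^sup>2)"
        using b by (auto simp: p_def inner_simps inner_commute power2_eq_square algebra_simps)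
      then show ?thesis by (auto intro!: derivative_eq_intros)
    qed
    have p0: "0 < p t" if "\<bar>t\<bar> < \<delta>" for t
    proof -
      have "norm (t *\<^sub>R b) < norm x" using that \<delta> b by simp
      then have "x + t *\<^sub>R b \<noteq> 0" by (metis add_eq_0_iff2 norm_minus_cancel less_irrefl)
      then show ?thesis by (simp add: p_def)
    qed
    have line: "((\<lambda>t. h (x + t *\<^sub>R b)) has_real_derivative h' (x + t *\<^sub>R b) b) (at t)"
      if "\<And>x. (h has_derivative h' x) (at x)" for h :: "'a \<Rightarrow> real" and h' t
      using has_derivative_along_line[OF that] by (simp add: has_real_derivative_iff_has_vector_derivative)
    have "(g has_real_derivative g' t) (at t)" if "\<bar>t\<bar> < \<delta>" for t
      unfolding g_def g'_def
      by (intro DERIV_diff line C2_deriv_D1[OF f] DERIV_chain2[OF W p] p0 that)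
    moreover have "(g' has_real_derivative
        f'' x b b - (W'' ?S * (2 * (x \<bullet> b)) * (2 * (x \<bullet> b)) + 2 * W' ?S)) (at 0)"
    proof -
      have "(g' has_real_derivative f'' (x + 0 *\<^sub>R b) b b -
          ((W'' (p 0) * (2 * (x \<bullet> b) + 2 * 0)) * (2 * (x \<bullet> b) + 2 * 0) + 2 * W' (p 0))) (at 0)"
        unfolding g'_def
        by (intro DERIV_diff line[of "\<lambda>x. f' x b"] C2_deriv_D2[OF f] DERIV_mult DERIV_chain2[OF W' p] p0)
           (use \<delta> in \<open>auto intro!: derivative_eq_intros\<close>)
      then show ?thesis by (simp add: p_def)
    qed
    moreover have "g t \<le> g 0" if "\<bar>t\<bar> < \<delta>" for t
      using touch[of "x + t *\<^sub>R b"] that b by (simp add: g_def p_def dist_norm)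
    ultimately have "g' 0 = 0" "f'' x b b - (W'' ?S * (2 * (x \<bullet> b)) * (2 * (x \<bullet> b)) + 2 * W' ?S) \<le> 0"
      using local_max_derivative_conditions[OF \<delta>(1), of g g'] by blast+
    then show ?thesis by (simp add: g'_def p_def power2_eq_square algebra_simps)
  qed
  have S: "(\<Sum>b\<in>Basis. (x \<bullet> b)\<^sup>2) = ?S"
    by (simp add: euclidean_inner[of x x] power2_eq_square)
  have "(\<Sum>b\<in>Basis. (f' x b)\<^sup>2) = (\<Sum>b\<in>Basis. 4 * (W' ?S)\<^sup>2 * (x \<bullet> b)\<^sup>2)"
    by (intro sum.cong refl) (simp add: * power_mult_distrib)
  then show "(\<Sum>b\<in>Basis. (f' x b)\<^sup>2) = 4 * (W' ?S)\<^sup>2 * ?S"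
    by (simp add: sum_distrib_left[symmetric] S)
  have "lap f'' x \<le> (\<Sum>b\<in>Basis. 2 * W' ?S + 4 * W'' ?S * (x \<bullet> b)\<^sup>2)"
    unfolding lap_def by (intro sum_mono) (simp add: *)
  also have "\<dots> = 2 * real DIM('a) * W' ?S + 4 * ?S * W'' ?S"
    by (simp add: sum.distrib sum_distrib_left[symmetric] S)
  finally show "lap f'' x \<le> 2 * real DIM('a) * W' ?S + 4 * ?S * W'' ?S" .
qed

text \<open>
  In terms of \<open>u = \<surd>f\<close> the hypothesis reads \<open>\<Delta>u \<ge> - \<kappa> \<bar>x\<bar>\<^bsup>-2\<^esup> u\<close>; it is stated for \<open>f\<close> because \<open>u\<close> need not
  be differentiable where \<open>f\<close> vanishes. Since \<open>\<alpha> + \<beta> = n - 2\<close>, both \<open>\<bar>x\<bar>\<^bsup>-\<alpha>\<^esup>\<close> and \<open>\<bar>x\<bar>\<^bsup>-\<beta>\<^esup>\<close> solve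
  \<open>\<Delta>w = - \<alpha> \<beta> \<bar>x\<bar>\<^bsup>-2\<^esup> w\<close>, so with \<open>\<kappa> < \<alpha> \<beta>\<close> every combination \<open>w = C \<bar>x\<bar>\<^bsup>-\<beta>\<^esup> + \<eta> \<bar>x\<bar>\<^bsup>-\<alpha>\<^esup>\<close> is a
  strict supersolution. It dominates \<open>u\<close> on the sphere of radius \<open>R\<close> if \<open>C\<close> is large, and near infinity for
  every \<open>\<eta> > 0\<close> by the assumed decay; hence everywhere in between, and \<open>\<eta>\<close> can be sent to \<open>0\<close>.
\<close>

lemma exterior_decay:
  fixes f :: "'a::euclidean_space \<Rightarrow> real" and \<alpha> \<beta> \<kappa> R :: real
  assumes f: "C2_deriv f f' f''" and nn: "\<And>x. 0 \<le> f x"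
    and \<alpha>: "0 < \<alpha>" and \<beta>: "0 < \<beta>" and sum: "\<alpha> + \<beta> = real DIM('a) - 2"
    and R: "0 < R" and \<kappa>: "\<kappa> < \<alpha> * \<beta>"
    and sub: "\<And>x. R \<le> norm x \<Longrightarrow>
      (\<Sum>b\<in>Basis. (f' x b)\<^sup>2) - 4 * \<kappa> * (f x)\<^sup>2 / (x \<bullet> x) \<le> 2 * f x * lap f'' x"
    and decay: "\<And>\<delta>. 0 < \<delta> \<Longrightarrow> \<exists>r. \<forall>x. r \<le> norm x \<longrightarrow> f x \<le> \<delta> * norm x powr (- 2 * \<alpha>)"
  shows "\<exists>C. \<forall>x. R \<le> norm x \<longrightarrow> f x \<le> C * norm x powr (- 2 * \<beta>)"
proof -
  have "compact (f ` cball 0 R)"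
    by (intro compact_continuous_image C2_deriv_cont0[OF f] compact_cball)
  then obtain c where c: "\<And>x. norm x \<le> R \<Longrightarrow> f x \<le> c"
    using bounded_imp_bdd_above[OF compact_imp_bounded] by (fastforce simp: bdd_above_def)
  have c0: "0 \<le> c" using c[of 0] nn[of 0] R by simp
  define C where "C = sqrt c * R powr \<beta>"
  have C: "0 \<le> C" using c0 by (simp add: C_def)
  have bound: "f x \<le> (C * norm x powr (- \<beta>) + \<eta> * norm x powr (- \<alpha>))\<^sup>2"
    if \<eta>: "0 < \<eta>" and x0: "R \<le> norm x" for \<eta> x
  proof (rule ccontr)
    assume neg: "\<not> ?thesis"
    \<comment> \<open>As a function of \<open>s = x \<bullet> x\<close>, which is smooth away from the origin.\<close>
    define w where "w s = C * s powr (- \<beta> / 2) + \<eta> * s powr (- \<alpha> / 2)" for s :: real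
    define w' where "w' s = C * (- \<beta> / 2) * s powr (- \<beta> / 2 - 1) + \<eta> * (- \<alpha> / 2) * s powr (- \<alpha> / 2 - 1)" for s :: real
    define w'' where "w'' s = C * (- \<beta> / 2) * (- \<beta> / 2 - 1) * s powr (- \<beta> / 2 - 1 - 1) +
        \<eta> * (- \<alpha> / 2) * (- \<alpha> / 2 - 1) * s powr (- \<alpha> / 2 - 1 - 1)" for s :: real
    have w_norm: "w (z \<bullet> z) = C * norm z powr (- \<beta>) + \<eta> * norm z powr (- \<alpha>)" for z :: 'a
    proof -
      have "(z \<bullet> z) powr (a / 2) = norm z powr a" if "z \<noteq> 0" for a
        using that by (simp add: dot_square_norm powr_powr flip: powr_numeral)
      from this[of "- \<beta>"] this[of "- \<alpha>"] show ?thesis by (cases "z = 0") (simp_all add: w_def)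
    qed
    have w0: "0 < w s" if "0 < s" for s
      unfolding w_def using C \<eta> that by (intro add_nonneg_pos) auto
    have dpow: "((\<lambda>s. k * s powr a) has_real_derivative k * a * s powr (a - 1)) (at s)" if "0 < s" for k a s :: real
      using that by (auto intro!: derivative_eq_intros)
    have dw: "(w has_real_derivative w' s) (at s)" if "0 < s" for s
      unfolding w_def w'_def by (intro DERIV_add dpow that)
    have dw': "(w' has_real_derivative w'' s) (at s)" if "0 < s" for s
      unfolding w'_def w''_def by (intro DERIV_add dpow that)
    \<comment> \<open>Both exponents satisfy the indicial equation \<open>a * (n - 2 - a) = \<alpha> * \<beta>\<close>.\<close>
    have euler: "2 * real DIM('a) * w' s + 4 * s * w'' s = - (\<alpha> * \<beta>) * w s / s" if s: "0 < s" for s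
    proof -
      have 1: "s powr (a - 1) = s powr a / s" for a
        using s by (simp add: powr_diff)
      have n: "real DIM('a) = \<alpha> + \<beta> + 2" using sum by simp
      show ?thesis
        unfolding w_def w'_def w''_def 1 n using s by (simp add: field_simps)
    qed
    obtain r where r: "\<And>x. r \<le> norm x \<Longrightarrow> f x \<le> \<eta>\<^sup>2 * norm x powr (- 2 * \<alpha>)"
      using decay[of "\<eta>\<^sup>2"] \<eta> by auto
    have far: "f z \<le> (w (z \<bullet> z))\<^sup>2" if "r \<le> norm z" for z
    proof -
      have "f z \<le> (\<eta> * norm z powr (- \<alpha>))\<^sup>2"
        using r[OF that]
        by (simp add: power_mult_distrib power2_eq_square[of "_ powr _"] powr_add[symmetric])
      also have "\<dots> \<le> (w (z \<bullet> z))\<^sup>2"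
        unfolding w_norm using C \<eta> by (intro power_mono) auto
      finally show ?thesis .
    qed
    have near: "f z \<le> (w (z \<bullet> z))\<^sup>2" if z: "norm z = R" for z
    proof -
      have "f z \<le> (sqrt c)\<^sup>2" using c[of z] c0 z by simp
      also have "sqrt c = C * norm z powr (- \<beta>)"
        using z R by (simp add: C_def mult.assoc powr_add[symmetric])
      also have "(C * norm z powr (- \<beta>))\<^sup>2 \<le> (w (z \<bullet> z))\<^sup>2"
        unfolding w_norm using C \<eta> by (intro power_mono) auto
      finally show ?thesis .
    qed
    define A where "A = {z::'a. R \<le> norm z \<and> norm z \<le> r}"
    have A: "A = cball 0 r - ball 0 R" by (auto simp: A_def)
    define h where "h z = f z / (w (z \<bullet> z))\<^sup>2" for z
    have big: "1 < h x"
    proof -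
      have "0 < w (x \<bullet> x)" using x0 R by (intro w0) auto
      then show ?thesis using neg by (simp add: h_def w_norm[symmetric])
    qed
    have "norm x < r" using neg far[of x] unfolding w_norm by linarith
    with x0 have xA: "x \<in> A" by (simp add: A_def)
    have pos: "0 < z \<bullet> z" if "R \<le> norm z" for z :: 'a using that R by auto
    have cw: "continuous_on {0<..} w"
      by (meson dw DERIV_continuous_on DERIV_subset greaterThan_iff subset_UNIV)
    have "continuous_on A (\<lambda>z. w (z \<bullet> z))"
      by (rule continuous_on_compose2[OF cw]) (auto intro!: continuous_intros simp: A_def dest: pos)
    then have "continuous_on A h"
      unfolding h_def
    proof (intro continuous_on_divide continuous_on_power C2_deriv_cont0[OF f] ballI)
      fix z assume "z \<in> A"
      then have "0 < w (z \<bullet> z)" using pos w0 by (simp add: A_def)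
      then show "(w (z \<bullet> z))\<^sup>2 \<noteq> 0" by simp
    qed
    moreover have "compact A" unfolding A by (intro compact_diff) auto
    ultimately obtain y where y: "y \<in> A" and max: "\<And>z. z \<in> A \<Longrightarrow> h z \<le> h y"
      using continuous_attains_sup[of A h] xA by blast
    define m where "m = h y"
    have m: "1 < m" using max[OF xA] big by (simp add: m_def)
    let ?S = "y \<bullet> y"
    have S: "0 < ?S" using y pos by (simp add: A_def)
    have wS: "0 < w ?S" using w0[OF S] .
    have fy: "f y = m * (w ?S)\<^sup>2" using wS by (simp add: m_def h_def)
    have strict: "\<not> f y \<le> (w ?S)\<^sup>2" using m wS by (simp add: fy)
    then have yr: "R < norm y" "norm y < r"
      using y near[of y] far[of y] by (auto simp: A_def less_le)
    define \<delta> where "\<delta> = min (norm y - R) (r - norm y)"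
    have \<delta>: "0 < \<delta>" "\<delta> \<le> norm y" using yr R by (auto simp: \<delta>_def)
    have touch: "f z - m * (w (z \<bullet> z))\<^sup>2 \<le> f y - m * (w ?S)\<^sup>2" if "z \<in> ball y \<delta>" for z
    proof -
      have "\<bar>norm z - norm y\<bar> < \<delta>"
        using that norm_triangle_ineq3[of z y] by (simp add: dist_norm norm_minus_commute)
      then have zA: "z \<in> A" by (auto simp: A_def \<delta>_def)
      then have "0 < w (z \<bullet> z)" using pos w0 by (simp add: A_def)
      then show ?thesis using max[OF zA] by (simp add: fy m_def[symmetric]) (simp add: h_def field_simps)
    qed
    have W: "((\<lambda>s. m * (w s)\<^sup>2) has_real_derivative m * (2 * w s * w' s)) (at s)" if "0 < s" for s
      using that by (auto intro!: derivative_eq_intros dw)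
    have W': "((\<lambda>s. m * (2 * w s * w' s)) has_real_derivative m * (2 * (w' s)\<^sup>2 + 2 * w s * w'' s)) (at s)"
      if "0 < s" for s
      using that by (auto intro!: derivative_eq_intros dw dw' simp: power2_eq_square algebra_simps)
    note t = touching_radial_function[OF f W W' \<delta> touch]
    have grad: "(\<Sum>b\<in>Basis. (f' y b)\<^sup>2) = 16 * m\<^sup>2 * (w ?S)\<^sup>2 * (w' ?S)\<^sup>2 * ?S"
      using t(1) by (simp add: power_mult_distrib)
    \<comment> \<open>At the touching point \<open>f = m * w\<^sup>2\<close>, and the gradient term cancels the square of \<open>w'\<close>
      that the second derivative of \<open>w\<^sup>2\<close> produces.\<close>
    have "2 * f y * lap f'' y \<le> 2 * f y * (2 * real DIM('a) * (m * (2 * w ?S * w' ?S)) +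
        4 * ?S * (m * (2 * (w' ?S)\<^sup>2 + 2 * w ?S * w'' ?S)))"
      using t(2) nn[of y] by (intro mult_left_mono) auto
    also have "\<dots> = 4 * m\<^sup>2 * (w ?S) ^ 3 * (2 * real DIM('a) * w' ?S + 4 * ?S * w'' ?S)
        + 16 * m\<^sup>2 * (w ?S)\<^sup>2 * (w' ?S)\<^sup>2 * ?S"
      unfolding fy by (simp add: algebra_simps power2_eq_square power3_eq_cube)
    also have "4 * m\<^sup>2 * (w ?S) ^ 3 * (2 * real DIM('a) * w' ?S + 4 * ?S * w'' ?S) = - 4 * (\<alpha> * \<beta>) * (f y)\<^sup>2 / ?S"
      unfolding euler[OF S] fy by (simp add: algebra_simps power2_eq_square power3_eq_cube)
    finally have "2 * f y * lap f'' y - (\<Sum>b\<in>Basis. (f' y b)\<^sup>2) \<le> - 4 * (\<alpha> * \<beta>) * (f y)\<^sup>2 / ?S"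
      unfolding grad by simp
    with sub[of y] yr have "4 * (\<alpha> * \<beta>) * (f y)\<^sup>2 / ?S \<le> 4 * \<kappa> * (f y)\<^sup>2 / ?S" by simp
    moreover have "0 < (f y)\<^sup>2" using m wS by (simp add: fy)
    ultimately have "\<alpha> * \<beta> \<le> \<kappa>" using S by (simp add: field_simps)
    then show False using \<kappa> by simp
  qed
  have "f x \<le> C\<^sup>2 * norm x powr (- 2 * \<beta>)" if x: "R \<le> norm x" for x
  proof -
    have "((\<lambda>\<eta>. (C * norm x powr (- \<beta>) + \<eta> * norm x powr (- \<alpha>))\<^sup>2) \<longlongrightarrow>
        (C * norm x powr (- \<beta>) + 0 * norm x powr (- \<alpha>))\<^sup>2) (at_right 0)"
      by (intro tendsto_intros)
    moreover have "\<forall>\<^sub>F \<eta> in at_right 0. f x \<le> (C * norm x powr (- \<beta>) + \<eta> * norm x powr (- \<alpha>))\<^sup>2"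
      using bound[OF _ x] by (auto simp: eventually_at_right_field intro: exI[of _ 1])
    ultimately have "f x \<le> (C * norm x powr (- \<beta>) + 0 * norm x powr (- \<alpha>))\<^sup>2"
      by (rule tendsto_lowerbound) simp
    also have "\<dots> = C\<^sup>2 * norm x powr (- 2 * \<beta>)"
      by (simp add: power_mult_distrib power2_eq_square[of "_ powr _"] powr_add[symmetric])
    finally show ?thesis .
  qed
  then show ?thesis by blast
qed

section \<open>Cutoff functions supported in annuli\<close>

text \<open>
  The cutoff \<open>G\<close> is constant near \<open>0\<close> and its derivative is \<open>- h\<close>, so that the boundary terms produced by \<open>G\<close> can be
  estimated with the weight \<open>h\<close> itself and no larger annulus is needed. The arguments will be squared
  radii, which is why the support of \<open>h\<close> is the interval from \<open>1\<close> to \<open>4\<close> and why \<open>G\<close> matters for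
  nonnegative arguments only.
\<close>

lemma annular_cutoff:
  obtains h h' h'' G :: "real \<Rightarrow> real" and c0
  where "\<And>s. (h has_real_derivative h' s) (at s)" "\<And>s. (h' has_real_derivative h'' s) (at s)"
    "continuous_on UNIV h''" "\<And>s. 0 \<le> h s"
    "\<And>s. s \<le> 1 \<or> 4 \<le> s \<Longrightarrow> h s = 0 \<and> h' s = 0 \<and> h'' s = 0"
    "\<And>s. 0 \<le> s \<Longrightarrow> (G has_real_derivative - h s) (at s)"
    "\<And>s. 4 \<le> s \<Longrightarrow> G s = 0" "\<And>s. 0 \<le> s \<Longrightarrow> 0 \<le> G s"
    "0 < c0" "\<And>s. 0 \<le> s \<Longrightarrow> s \<le> 1 \<Longrightarrow> G s = c0"
proof -
  define u v :: "real \<Rightarrow> real" where "u s = max 0 (s - 1)" and "v s = max 0 (4 - s)" for s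
  have du: "((\<lambda>s. u s ^ Suc (Suc k)) has_real_derivative real (Suc (Suc k)) * u s ^ Suc k * 1) (at s)" for k s
    unfolding u_def by (rule DERIV_chain2[OF DERIV_max_0_power]) (auto intro!: derivative_eq_intros)
  have dv: "((\<lambda>s. v s ^ Suc (Suc k)) has_real_derivative real (Suc (Suc k)) * v s ^ Suc k * - 1) (at s)" for k s
    unfolding v_def by (rule DERIV_chain2[OF DERIV_max_0_power]) (auto intro!: derivative_eq_intros)
  have u: "((\<lambda>s. u s ^ 3) has_real_derivative 3 * u s ^ 2) (at s)"
    "((\<lambda>s. u s ^ 2) has_real_derivative 2 * u s) (at s)" for s
    using du[of 1 s] du[of 0 s] by (simp_all add: numeral_2_eq_2 numeral_3_eq_3)
  have v: "((\<lambda>s. v s ^ 3) has_real_derivative - 3 * v s ^ 2) (at s)"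
    "((\<lambda>s. v s ^ 2) has_real_derivative - 2 * v s) (at s)" for s
    using dv[of 1 s] dv[of 0 s] by (simp_all add: numeral_2_eq_2 numeral_3_eq_3)
  define h where "h s = u s ^ 3 * v s ^ 3" for s
  define h' where "h' s = 3 * (u s ^ 2 * v s ^ 3) - 3 * (u s ^ 3 * v s ^ 2)" for s
  define h'' where "h'' s = 6 * (u s * v s ^ 3) - 18 * (u s ^ 2 * v s ^ 2) + 6 * (u s ^ 3 * v s)" for s
  have h: "(h has_real_derivative h' s) (at s)" for s
    unfolding h_def[abs_def]
    by (rule DERIV_cong[OF DERIV_mult[OF u(1) v(1)]]) (simp add: h'_def)
  have h': "(h' has_real_derivative h'' s) (at s)" for s
    unfolding h'_def[abs_def]
    by (rule DERIV_cong[OF DERIV_diff[OF DERIV_cmult[OF DERIV_mult[OF u(2) v(1)]]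
            DERIV_cmult[OF DERIV_mult[OF u(1) v(2)]]]])
       (simp add: h''_def algebra_simps)
  have cont: "continuous_on S u" "continuous_on S v" for S
    unfolding u_def v_def by (intro continuous_intros)+
  have cont_h: "continuous_on S h" for S
    unfolding h_def by (intro continuous_intros cont)
  have h0: "0 \<le> h s" for s by (simp add: h_def u_def v_def)
  have hz: "h s = 0 \<and> h' s = 0 \<and> h'' s = 0" if "s \<le> 1 \<or> 4 \<le> s" for s
    using that by (auto simp: h_def h'_def h''_def u_def v_def)
  have int: "h integrable_on {a..b}" for a b
    by (intro integrable_continuous_interval cont_h)
  define c0 where "c0 = integral {-1..4} h"
  define G where "G s = c0 - integral {-1..s} h" for s
  have dG: "(G has_real_derivative - h s) (at s)" if "0 \<le> s" for s
  proof -
    have "((\<lambda>t. integral {-1..t} h) has_real_derivative h s) (at s within {-1..s + 1})"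
      using that by (intro integral_has_real_derivative cont_h) auto
    then have "((\<lambda>t. integral {-1..t} h) has_real_derivative h s) (at s)"
      using that by (subst (asm) at_within_Icc_at) auto
    from DERIV_diff[OF DERIV_const this] show ?thesis by (simp add: G_def[abs_def])
  qed
  have "integral {4..s} h = 0" for s
    by (intro integral_unique has_integral_is_0) (use hz in auto)
  then have G4: "G s = 0" if "4 \<le> s" for s
    using that Henstock_Kurzweil_Integration.integral_combine[of "-1" 4 s h] int by (simp add: G_def c0_def)
  have G0: "0 \<le> G s" if "0 \<le> s" for s
  proof (cases "4 \<le> s")
    case False
    then have "integral {-1..s} h \<le> integral {-1..4} h"
      by (intro integral_subset_le int) (auto simp: h0)
    then show ?thesis by (simp add: G_def c0_def)
  qed (simp add: G4)
  have "0 \<le> c0" unfolding c0_def by (intro integral_nonneg int h0)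
  moreover have "c0 \<noteq> 0"
  proof
    assume "c0 = 0"
    then have "\<forall>x\<in>{-1..4}. h x = 0"
      unfolding c0_def by (subst (asm) integral_eq_0_iff) (auto simp: h0 cont_h)
    then have "h 2 = 0" by auto
    then show False by (simp add: h_def u_def v_def)
  qed
  ultimately have c0: "0 < c0" by simp
  have G1: "G s = c0" if "0 \<le> s" "s \<le> 1" for s
  proof -
    have "integral {-1..s} h = 0" by (intro integral_unique has_integral_is_0) (use hz that in auto)
    then show ?thesis by (simp add: G_def)
  qed
  have "continuous_on UNIV h''" unfolding h''_def by (intro continuous_intros cont)
  from that[OF h h' this h0 hz dG G4 G0 c0 G1] show ?thesis by blast
qed

lemma bounded_of_support:
  fixes f :: "real \<Rightarrow> real"
  assumes "continuous_on UNIV f" "\<And>s. s \<le> a \<or> b \<le> s \<Longrightarrow> f s = 0"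
  obtains M where "0 \<le> M" "\<And>s. \<bar>f s\<bar> \<le> M"
proof -
  have "bounded (f ` {a..b})"
    by (intro compact_imp_bounded compact_continuous_image continuous_on_subset[OF assms(1)]) auto
  then obtain M where M: "\<And>s. s \<in> {a..b} \<Longrightarrow> \<bar>f s\<bar> \<le> M" by (force simp: bounded_iff)
  have "\<bar>f s\<bar> \<le> max 0 M" for s
  proof (cases "s \<in> {a..b}")
    case True then show ?thesis using M by fastforce
  next
    case False then show ?thesis using assms(2)[of s] by auto
  qed
  then show ?thesis using that[of "max 0 M"] by simp
qed

lemma C2_deriv_radial:
  fixes h h' h'' :: "real \<Rightarrow> real" and \<rho> :: real
  assumes h: "\<And>s. (h has_real_derivative h' s) (at s)" "\<And>s. (h' has_real_derivative h'' s) (at s)"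
    and cont: "continuous_on UNIV h''" and \<rho>: "\<rho> \<noteq> 0"
  shows "C2_deriv (\<lambda>x::'a::euclidean_space. h (x \<bullet> x / \<rho>)) (\<lambda>x v. h' (x \<bullet> x / \<rho>) * (2 * (x \<bullet> v) / \<rho>))
    (\<lambda>x u v. h'' (x \<bullet> x / \<rho>) * (2 * (x \<bullet> v) / \<rho>) * (2 * (x \<bullet> u) / \<rho>) + h' (x \<bullet> x / \<rho>) * (2 * (u \<bullet> v) / \<rho>))"
  unfolding C2_deriv_def
proof (intro conjI allI)
  fix x u v :: 'a
  have d: "((\<lambda>x. k (x \<bullet> x / \<rho>)) has_derivative (\<lambda>v. k' (x \<bullet> x / \<rho>) * (2 * (x \<bullet> v) / \<rho>))) (at x)"
    if "\<And>s. (k has_real_derivative k' s) (at s)" for k k' :: "real \<Rightarrow> real"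
  proof -
    have "((\<lambda>s. k (s / \<rho>)) has_real_derivative k' (x \<bullet> x / \<rho>) * (1 / \<rho>)) (at (x \<bullet> x))"
      by (rule DERIV_chain2[OF that DERIV_cdivide[OF DERIV_ident]])
    from has_derivative_radial[OF this] show ?thesis by simp
  qed
  show "((\<lambda>x. h (x \<bullet> x / \<rho>)) has_derivative (\<lambda>v. h' (x \<bullet> x / \<rho>) * (2 * (x \<bullet> v) / \<rho>))) (at x)"
    by (rule d[OF h(1)])
  have "((\<lambda>x. 2 * (x \<bullet> u) / \<rho>) has_derivative (\<lambda>v. 2 * (v \<bullet> u) / \<rho>)) (at x)"
    using \<rho> by (auto intro!: derivative_eq_intros)
  from has_derivative_mult[OF d[OF h(2)] this]
  show "((\<lambda>x. h' (x \<bullet> x / \<rho>) * (2 * (x \<bullet> u) / \<rho>)) has_derivative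
     (\<lambda>v. h'' (x \<bullet> x / \<rho>) * (2 * (x \<bullet> v) / \<rho>) * (2 * (x \<bullet> u) / \<rho>) + h' (x \<bullet> x / \<rho>) * (2 * (u \<bullet> v) / \<rho>))) (at x)"
    by (rule has_derivative_eq_rhs) (simp add: fun_eq_iff inner_commute)
  have "continuous_on UNIV h'"
    by (rule DERIV_continuous_on[OF DERIV_subset[OF h(2)]]) auto
  note c = this cont
  have "continuous_on UNIV (\<lambda>x::'a. x \<bullet> x / \<rho>)"
    by (intro continuous_intros) (use \<rho> in auto)
  note c' = continuous_on_compose2[OF c(1) this] continuous_on_compose2[OF c(2) this]
  show "continuous_on UNIV (\<lambda>x. h'' (x \<bullet> x / \<rho>) * (2 * (x \<bullet> v) / \<rho>) * (2 * (x \<bullet> u) / \<rho>) + h' (x \<bullet> x / \<rho>) * (2 * (u \<bullet> v) / \<rho>))"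
    by (intro continuous_intros c') (use \<rho> in auto)
qed


section \<open>Homogeneous elliptic systems and the Pohozaev identity\<close>

text \<open>
  The setting of the theorem without coordinates: \<open>T\<close> is the linear map of the matrix \<open>A\<close>, and the
  system is tested with an arbitrary vector \<open>w\<close>.
\<close>

locale homogeneous_system =
  fixes T :: "'b::euclidean_space \<Rightarrow> 'b"
    and P :: "'b \<Rightarrow> real" and P' :: "'b \<Rightarrow> 'b \<Rightarrow> real"
    and V :: "'a::euclidean_space \<Rightarrow> 'b" and V' :: "'a \<Rightarrow> 'a \<Rightarrow> 'b" and V'' :: "'a \<Rightarrow> 'a \<Rightarrow> 'a \<Rightarrow> 'b"
    and q :: real
  assumes T_linear: "linear T"
    and T_sym: "u \<bullet> T v = v \<bullet> T u"
    and T_pos: "v \<noteq> 0 \<Longrightarrow> 0 < v \<bullet> T v"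
    and P_deriv: "(P has_derivative P' v) (at v)"
    and P_hom: "pos_homogeneous (q + 1) P"
    and q_gt_1: "1 < q"
    and V_C2: "C2_deriv V V' V''"
    and system: "T (lap V'' x) \<bullet> w = P' (V x) w"
begin

definition Q :: "'a \<Rightarrow> real" where "Q x = V x \<bullet> T (V x)"
definition Q' :: "'a \<Rightarrow> 'a \<Rightarrow> real" where "Q' x v = 2 * (V x \<bullet> T (V' x v))"
definition Q'' :: "'a \<Rightarrow> 'a \<Rightarrow> 'a \<Rightarrow> real" where
  "Q'' x u v = 2 * (V' x v \<bullet> T (V' x u)) + 2 * (V x \<bullet> T (V'' x u v))"
definition energy :: "'a \<Rightarrow> real" where "energy x = (\<Sum>b\<in>Basis. V' x b \<bullet> T (V' x b))"

lemma T_nonneg: "0 \<le> v \<bullet> T v"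
  using T_pos[of v] by (cases "v = 0") auto

lemma T_Cauchy_Schwarz: "(u \<bullet> T v)\<^sup>2 \<le> (u \<bullet> T u) * (v \<bullet> T v)"
proof (cases "u = 0")
  case False
  define a b where "a = u \<bullet> T u" and "b = u \<bullet> T v"
  have a: "0 < a" using T_pos[OF False] by (simp add: a_def)
  have "0 \<le> (a *\<^sub>R v - b *\<^sub>R u) \<bullet> T (a *\<^sub>R v - b *\<^sub>R u)" by (rule T_nonneg)
  also have "\<dots> = a * (a * (v \<bullet> T v) - b\<^sup>2)"
    using T_sym[of v u]
    by (simp add: linear_diff[OF T_linear] linear_cmul[OF T_linear] inner_simps a_def b_def
        power2_eq_square algebra_simps)
  finally show ?thesis using a by (simp add: zero_le_mult_iff a_def b_def)
qed simp

lemma T_AM_GM: "\<bar>u \<bullet> T v\<bar> \<le> (u \<bullet> T u + v \<bullet> T v) / 2"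
proof -
  have "(u \<bullet> T v)\<^sup>2 \<le> ((u \<bullet> T u + v \<bullet> T v) / 2)\<^sup>2"
    using T_Cauchy_Schwarz[of u v] sum_squares_bound[of "u \<bullet> T u" "v \<bullet> T v"]
    by (simp add: power2_eq_square field_simps)
  then show ?thesis
    using T_nonneg[of u] T_nonneg[of v] by (intro power2_le_imp_le[of "\<bar>u \<bullet> T v\<bar>"]) auto
qed

lemma has_derivative_T_form:
  assumes "(f has_derivative f') (at x)" "(g has_derivative g') (at x)"
  shows "((\<lambda>x. f x \<bullet> T (g x)) has_derivative (\<lambda>v. f x \<bullet> T (g' v) + f' v \<bullet> T (g x))) (at x)"
  by (rule has_derivative_inner[OF assms(1)
        bounded_linear.has_derivative[OF linear_conv_bounded_linear[THEN iffD1, OF T_linear] assms(2)]])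

lemma continuous_on_T [continuous_intros]:
  "continuous_on S f \<Longrightarrow> continuous_on S (\<lambda>x. T (f x))"
  by (rule continuous_on_compose2[OF linear_continuous_on[OF linear_conv_bounded_linear[THEN iffD1, OF T_linear], of UNIV]]) auto

lemmas V_D1 = C2_deriv_D1[OF V_C2] and V_D2 = C2_deriv_D2[OF V_C2]
  and V_cont = C2_deriv_cont0[OF V_C2] C2_deriv_cont1[OF V_C2] C2_deriv_cont2[OF V_C2]

lemma Q_nonneg: "0 \<le> Q x" and energy_nonneg: "0 \<le> energy x"
  by (auto simp: Q_def energy_def T_nonneg intro!: sum_nonneg)

lemma continuous_on_energy [continuous_intros]: "continuous_on S energy"
  unfolding energy_def[abs_def] by (intro continuous_intros V_cont)

lemma continuous_on_P: "continuous_on S P"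
  by (rule has_derivative_continuous_on[OF has_derivative_at_withinI[OF P_deriv]])

lemma continuous_on_P_V [continuous_intros]: "continuous_on S (\<lambda>x. P (V x))"
  by (rule continuous_on_compose2[OF continuous_on_P[of UNIV] V_cont(1)]) auto

lemma Q_C2: "C2_deriv Q Q' Q''"
  unfolding C2_deriv_def
proof (intro conjI allI)
  fix x u v
  show "(Q has_derivative Q' x) (at x)"
    unfolding Q_def[abs_def]
    by (rule has_derivative_eq_rhs[OF has_derivative_T_form[OF V_D1 V_D1]])
       (simp add: Q'_def fun_eq_iff T_sym[of "V' x _" "V x"])
  show "((\<lambda>y. Q' y v) has_derivative Q'' x v) (at x)"
    unfolding Q'_def
    by (rule has_derivative_eq_rhs[OF has_derivative_mult_right[OF has_derivative_T_form[OF V_D1 V_D2]]])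
       (simp add: Q''_def fun_eq_iff algebra_simps)
  show "continuous_on UNIV (\<lambda>x. Q'' x u v)"
    unfolding Q''_def by (intro continuous_intros V_cont)
qed

lemma P_scale: "0 < t \<Longrightarrow> P (t *\<^sub>R v) = t powr (q + 1) * P v"
  using P_hom by (auto simp: pos_homogeneous_def)

text \<open>
  Differentiate \<open>P (t *\<^sub>R v) = t powr (q + 1) * P v\<close> at \<open>t = 1\<close>.
\<close>

lemma Euler_identity: "P' v v = (q + 1) * P v"
proof -
  have "((\<lambda>t. P (0 + t *\<^sub>R v)) has_real_derivative P' (0 + 1 *\<^sub>R v) v) (at 1)"
    using has_derivative_along_line[OF P_deriv] by (simp only: has_real_derivative_iff_has_vector_derivative)
  then have 1: "((\<lambda>t. P (t *\<^sub>R v)) has_real_derivative P' v v) (at 1)" by simp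
  have "((\<lambda>t. t powr (q + 1) * P v) has_real_derivative (q + 1) * P v) (at 1)"
    by (auto intro!: derivative_eq_intros)
  then have "((\<lambda>t. P (t *\<^sub>R v)) has_real_derivative (q + 1) * P v) (at 1)"
    by (rule has_field_derivative_transform_within_open[where S = "{0<..}"]) (auto simp: P_scale)
  with 1 show ?thesis by (rule DERIV_unique)
qed

text \<open>
  Homogeneity reduces the estimate to the unit sphere, where \<open>P\<close> is bounded and the quadratic form of \<open>T\<close> is bounded
  below by a positive constant. Homogeneity at the origin gives \<open>P 0 = 0\<close>.
\<close>

lemma P_bound: "\<exists>K\<ge>0. \<forall>v. \<bar>P v\<bar> \<le> K * (v \<bullet> T v) powr ((q + 1) / 2)"
proof -
  let ?S = "sphere (0::'b) 1"
  have ne: "?S \<noteq> {}" by (metis SOME_Basis mem_sphere_0 norm_Basis empty_iff)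
  obtain K0 where K0: "\<And>u. norm u = 1 \<Longrightarrow> \<bar>P u\<bar> \<le> K0"
  proof -
    have "bounded (P ` ?S)"
      by (intro compact_imp_bounded compact_continuous_image continuous_on_P compact_sphere)
    then show ?thesis using that by (force simp: bounded_iff)
  qed
  obtain u0 where u0: "norm u0 = 1" "\<And>u. norm u = 1 \<Longrightarrow> u0 \<bullet> T u0 \<le> u \<bullet> T u"
  proof -
    have "continuous_on ?S (\<lambda>u. u \<bullet> T u)" by (intro continuous_intros)
    from continuous_attains_inf[OF compact_sphere ne this] show ?thesis using that by auto
  qed
  define c where "c = u0 \<bullet> T u0"
  have c: "0 < c" using T_pos[of u0] u0(1) by (force simp: c_def)
  have K0': "0 \<le> K0" using K0[OF u0(1)] by linarith
  have "\<bar>P v\<bar> \<le> (K0 / c powr ((q + 1) / 2)) * (v \<bullet> T v) powr ((q + 1) / 2)" for v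
  proof (cases "v = 0")
    case True
    have "P 0 = 2 powr (q + 1) * P 0" using P_scale[of 2 0] by simp
    moreover have "2 powr (q + 1) \<noteq> (1::real)" using q_gt_1 by simp
    ultimately have "P 0 = 0" by simp
    then show ?thesis using True by simp
  next
    case False
    define u where "u = (1 / norm v) *\<^sub>R v"
    have u: "norm u = 1" and v: "v = norm v *\<^sub>R u" using False by (auto simp: u_def)
    have "v \<bullet> T v = (norm v)\<^sup>2 * (u \<bullet> T u)"
      by (subst (1 2) v) (simp add: linear_cmul[OF T_linear] power2_eq_square)
    then have "c * (norm v)\<^sup>2 \<le> v \<bullet> T v"
      using mult_right_mono[OF u0(2)[OF u], of "(norm v)\<^sup>2"] by (simp add: c_def mult.commute)
    then have "(c * (norm v)\<^sup>2) powr ((q + 1) / 2) \<le> (v \<bullet> T v) powr ((q + 1) / 2)"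
      using c q_gt_1 by (intro powr_mono2) auto
    moreover have "(c * (norm v)\<^sup>2) powr ((q + 1) / 2) = c powr ((q + 1) / 2) * norm v powr (q + 1)"
    proof -
      have "(norm v)\<^sup>2 powr ((q + 1) / 2) = norm v powr (2 * ((q + 1) / 2))"
        using False powr_powr[of "norm v" 2 "(q + 1) / 2"] by simp
      also have "2 * ((q + 1) / 2) = q + 1" by simp
      finally show ?thesis using c by (simp add: powr_mult)
    qed
    ultimately have *: "norm v powr (q + 1) \<le> (v \<bullet> T v) powr ((q + 1) / 2) / c powr ((q + 1) / 2)"
      using c by (simp add: pos_le_divide_eq mult.commute)
    have "\<bar>P v\<bar> = norm v powr (q + 1) * \<bar>P u\<bar>"
      using False by (subst v) (simp add: P_scale abs_mult)
    also have "\<dots> \<le> (v \<bullet> T v) powr ((q + 1) / 2) / c powr ((q + 1) / 2) * K0"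
      using * K0[OF u] by (intro mult_mono) auto
    finally show ?thesis by (simp add: mult.commute)
  qed
  moreover have "0 \<le> K0 / c powr ((q + 1) / 2)" using K0' by simp
  ultimately show ?thesis by blast
qed

lemma lap_Q: "lap Q'' x = 2 * energy x + 2 * (q + 1) * P (V x)"
proof -
  have "lap Q'' x = 2 * energy x + 2 * (V x \<bullet> T (lap V'' x))"
    by (simp add: lap_def Q''_def energy_def sum.distrib sum_distrib_left linear_sum[OF T_linear] inner_sum_right)
  also have "V x \<bullet> T (lap V'' x) = (q + 1) * P (V x)"
    using system[of x "V x"] Euler_identity[of "V x"] by (simp add: inner_commute)
  finally show ?thesis by simp
qed

text \<open>
  Cauchy-Schwarz for the form of \<open>T\<close>. Together with the formula for \<open>lap Q''\<close> this is the statement that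
  \<open>\<surd>Q\<close>, and not only \<open>Q\<close>, satisfies a differential inequality.
\<close>

lemma gradient_Q: "(\<Sum>b\<in>Basis. (Q' x b)\<^sup>2) \<le> 4 * Q x * energy x"
proof -
  have "(\<Sum>b\<in>Basis. (Q' x b)\<^sup>2) \<le> (\<Sum>b\<in>Basis. 4 * Q x * (V' x b \<bullet> T (V' x b)))"
    using T_Cauchy_Schwarz[of "V x"]
    by (intro sum_mono) (simp add: Q'_def Q_def power_mult_distrib mult.assoc)
  then show ?thesis by (simp add: energy_def sum_distrib_left)
qed

text \<open>
  With \<open>w = V' x x \<bullet> T (V' x x)\<close> expand only the first factor in the basis. Cauchy-Schwarz, for the sum over
  the basis and then for the form of \<open>T\<close>, gives \<open>w\<^sup>2 \<le> (x \<bullet> x) * energy x * w\<close>.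
\<close>

lemma radial_derivative_le: "V' x x \<bullet> T (V' x x) \<le> (x \<bullet> x) * energy x"
proof -
  define w where "w = V' x x \<bullet> T (V' x x)"
  define a where "a b = V' x b \<bullet> T (V' x x)" for b
  have w0: "0 \<le> w" by (simp add: w_def T_nonneg)
  have "w = (\<Sum>b\<in>Basis. (x \<bullet> b) * a b)"
    unfolding w_def a_def
    by (subst linear_Basis_expand[OF C2_deriv_linear1[OF V_C2], of x x]) (simp add: inner_sum_left)
  then have "w\<^sup>2 \<le> (\<Sum>b\<in>Basis. (x \<bullet> b)\<^sup>2) * (\<Sum>b\<in>Basis. (a b)\<^sup>2)"
    using Cauchy_Schwarz_ineq_sum by metis
  also have "(\<Sum>b\<in>Basis. (x \<bullet> b)\<^sup>2) = x \<bullet> x"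
    by (simp add: euclidean_inner[of x x] power2_eq_square)
  also have "(\<Sum>b\<in>Basis. (a b)\<^sup>2) \<le> (\<Sum>b\<in>Basis. (V' x b \<bullet> T (V' x b)) * w)"
    unfolding a_def w_def by (intro sum_mono T_Cauchy_Schwarz)
  also have "\<dots> = energy x * w" by (simp add: energy_def sum_distrib_right)
  finally have "w * w \<le> ((x \<bullet> x) * energy x) * w"
    by (simp add: mult_left_mono power2_eq_square mult.assoc)
  then show ?thesis
    using w0 energy_nonneg[of x] by (cases "w = 0") (auto simp: w_def[symmetric])
qed

text \<open>
  The divergence theorem for \<open>g (x \<bullet> x)\<close> times the field \<open>Z\<close>. In the divergence of \<open>Z\<close> the terms with second
  derivatives cancel: those of the first summand against the gradient of \<open>energy / 2\<close>, by symmetry of the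
  second derivative, and \<open>T (lap V'') \<bullet> W\<close> against the gradient of \<open>P (V x)\<close>, by the system. The value of \<open>c\<close>
  is the one for which \<open>c * (q + 1) * P (V x)\<close>, which arises from the last summand, cancels the remaining
  multiple of \<open>P (V x)\<close>.
\<close>

lemma Pohozaev_identity:
  fixes g k :: "real \<Rightarrow> real"
  assumes g: "\<And>s. 0 \<le> s \<Longrightarrow> (g has_real_derivative - k s) (at s)"
    and k: "continuous_on UNIV k"
    and supp: "\<And>x::'a. x \<notin> cbox lo hi \<Longrightarrow> g (x \<bullet> x) = 0"
    and c: "c = real DIM('a) / (q + 1)"
  shows "(1 - real DIM('a) / 2 + c) * integral (cbox lo hi) (\<lambda>x. g (x \<bullet> x) * energy x) =
    integral (cbox lo hi) (\<lambda>x. 2 * k (x \<bullet> x) *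
      (V' x x \<bullet> T (V' x x) - (x \<bullet> x) * (energy x / 2 + P (V x)) + c * (V x \<bullet> T (V' x x))))"
proof -
  note lin1 = C2_deriv_linear1[OF V_C2]
  define W where "W x = (\<Sum>j\<in>Basis. (x \<bullet> j) *\<^sub>R V' x j)" for x
  define W' where "W' x v = (\<Sum>j\<in>Basis. (x \<bullet> j) *\<^sub>R V'' x j v + (v \<bullet> j) *\<^sub>R V' x j)" for x v
  define E' where "E' x v = (\<Sum>j\<in>Basis. V' x j \<bullet> T (V'' x j v)) + T (lap V'' x) \<bullet> V' x v" for x v
  define Z where "Z b x = W x \<bullet> T (V' x b) - (x \<bullet> b) * (energy x / 2 + P (V x)) + c * (V x \<bullet> T (V' x b))" for b x
  define Z' where "Z' b x v = (W x \<bullet> T (V'' x b v) + W' x v \<bullet> T (V' x b))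
     - ((x \<bullet> b) * E' x v + (v \<bullet> b) * (energy x / 2 + P (V x)))
     + c * (V x \<bullet> T (V'' x b v) + V' x v \<bullet> T (V' x b))" for b x v
  have W: "W x = V' x x" for x
    unfolding W_def using linear_Basis_expand[OF lin1, of x x] by simp
  have dW: "(W has_derivative W' x) (at x)" for x
    unfolding W_def[abs_def]
    by (rule has_derivative_eq_rhs[OF has_derivative_sum[OF has_derivative_scaleR[OF
            has_derivative_inner_left[OF has_derivative_ident] V_D2]]])
       (simp add: W'_def fun_eq_iff)
  have dE: "((\<lambda>x. energy x / 2 + P (V x)) has_derivative E' x) (at x)" for x
  proof -
    have "(energy has_derivative (\<lambda>v. \<Sum>j\<in>Basis. V' x j \<bullet> T (V'' x j v) + V'' x j v \<bullet> T (V' x j))) (at x)"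
      unfolding energy_def[abs_def] by (intro has_derivative_sum has_derivative_T_form V_D2)
    from has_derivative_add[OF bounded_linear.has_derivative[OF bounded_linear_divide[of 2] this]
        has_derivative_compose[OF V_D1 P_deriv]]
    show ?thesis
      by (rule has_derivative_eq_rhs)
         (simp add: E'_def fun_eq_iff system T_sym[of "V'' x _ _" "V' x _"] sum.distrib
             sum_distrib_left[symmetric])
  qed
  have dZ: "(Z b has_derivative Z' b x) (at x)" for b x
    unfolding Z_def[abs_def] Z'_def
    by (intro has_derivative_add has_derivative_diff has_derivative_mult has_derivative_mult_right
        has_derivative_T_form dW dE V_D1 V_D2 has_derivative_inner_left has_derivative_ident)
  have div: "(\<Sum>b\<in>Basis. Z' b x b) = (1 - real DIM('a) / 2 + c) * energy x" for x
  proof -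
    have 1: "(\<Sum>b\<in>Basis. W x \<bullet> T (V'' x b b)) = T (lap V'' x) \<bullet> W x"
      by (simp add: lap_def inner_sum_right[symmetric] linear_sum[OF T_linear, symmetric] inner_commute)
    have 2: "(\<Sum>b\<in>Basis. W' x b \<bullet> T (V' x b)) =
      (\<Sum>b\<in>Basis. \<Sum>j\<in>Basis. (x \<bullet> j) * (V'' x j b \<bullet> T (V' x b))) + energy x"
    proof -
      have "W' x b = (\<Sum>j\<in>Basis. (x \<bullet> j) *\<^sub>R V'' x j b) + V' x b" if "b \<in> Basis" for b
        using linear_Basis_expand[OF lin1, of x b] by (simp add: W'_def sum.distrib)
      then show ?thesis
        by (simp add: energy_def sum.distrib inner_add_left inner_sum_left)
    qed
    have 3: "(\<Sum>b\<in>Basis. (x \<bullet> b) * E' x b) =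
      (\<Sum>b\<in>Basis. \<Sum>j\<in>Basis. (x \<bullet> j) * (V'' x j b \<bullet> T (V' x b))) + T (lap V'' x) \<bullet> W x"
    proof -
      have "(\<Sum>b\<in>Basis. (x \<bullet> b) * E' x b) =
        (\<Sum>b\<in>Basis. \<Sum>j\<in>Basis. (x \<bullet> b) * (V'' x b j \<bullet> T (V' x j))) + T (lap V'' x) \<bullet> W x"
        by (simp add: E'_def W_def sum.distrib ring_distribs inner_sum_right sum_distrib_left
            T_sym[of "V' x _"] second_derivative_symmetric[OF V_C2, of x _ _])
      then show ?thesis by (subst (asm) sum.swap)
    qed
    have 4: "(\<Sum>b\<in>Basis. V x \<bullet> T (V'' x b b)) = (q + 1) * P (V x)"
      using system[of x "V x"] Euler_identity[of "V x"]
      by (simp add: lap_def inner_sum_right[symmetric] linear_sum[OF T_linear, symmetric] inner_commute)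
    have 5: "(\<Sum>b\<in>(Basis::'a set). (b \<bullet> b) * (energy x / 2 + P (V x))) = real DIM('a) * (energy x / 2 + P (V x))"
      by simp
    have "(\<Sum>b\<in>Basis. Z' b x b) = energy x - real DIM('a) * (energy x / 2 + P (V x)) + c * ((q + 1) * P (V x) + energy x)"
      unfolding Z'_def sum.distrib sum_subtractf sum_distrib_left[symmetric] 1 2 3 4 5
      by (simp add: energy_def)
    also have "\<dots> = energy x - real DIM('a) * (energy x / 2 + P (V x)) + (c * (q + 1)) * P (V x) + c * energy x"
      by (simp add: algebra_simps)
    also have "c * (q + 1) = real DIM('a)"
      using q_gt_1 by (simp add: c)
    also have "energy x - real DIM('a) * (energy x / 2 + P (V x)) + real DIM('a) * P (V x) + c * energy x = (1 - real DIM('a) / 2 + c) * energy x"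
      by (simp add: algebra_simps)
    finally show ?thesis .
  qed
  define \<phi>' where "\<phi>' x v = - k (x \<bullet> x) * (2 * (x \<bullet> v))" for x v :: 'a
  have d\<phi>: "((\<lambda>x. g (x \<bullet> x)) has_derivative \<phi>' x) (at x)" for x :: 'a
    unfolding \<phi>'_def by (rule has_derivative_radial[OF g]) simp
  have cZ: "continuous_on S (\<lambda>x. Z b x)" "continuous_on S (\<lambda>x. Z' b x v)" for S b v
    unfolding Z_def Z'_def W_def W'_def E'_def
    by (intro continuous_intros V_cont continuous_on_lap[OF V_C2]; simp)+
  have c\<phi>: "continuous_on S (\<lambda>x. g (x \<bullet> x))" "continuous_on S (\<lambda>x. k (x \<bullet> x))"
    "continuous_on S (\<lambda>x. \<phi>' x v)" for S :: "'a set" and v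
  proof -
    show "continuous_on S (\<lambda>x. g (x \<bullet> x))"
      by (rule has_derivative_continuous_on[OF has_derivative_at_withinI[OF d\<phi>]])
    show *: "continuous_on S (\<lambda>x. k (x \<bullet> x))"
      by (intro continuous_on_compose2[OF k] continuous_intros) auto
    show "continuous_on S (\<lambda>x. \<phi>' x v)"
      unfolding \<phi>'_def by (intro continuous_intros *)
  qed
  have "integral (cbox lo hi) (\<lambda>x. \<Sum>b\<in>Basis. g (x \<bullet> x) * Z' b x b + \<phi>' x b * Z b x) = 0"
    by (rule integral_divergence_eq_0[where F' = "\<lambda>b x v. g (x \<bullet> x) * Z' b x v + \<phi>' x v * Z b x",
          OF has_derivative_mult[OF d\<phi> dZ]])
       (auto intro!: continuous_intros cZ c\<phi> simp: supp)
  also have "(\<lambda>x. \<Sum>b\<in>Basis. g (x \<bullet> x) * Z' b x b + \<phi>' x b * Z b x) =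
    (\<lambda>x. (1 - real DIM('a) / 2 + c) * (g (x \<bullet> x) * energy x) - 2 * k (x \<bullet> x) *
      (V' x x \<bullet> T (V' x x) - (x \<bullet> x) * (energy x / 2 + P (V x)) + c * (V x \<bullet> T (V' x x))))"
  proof
    fix x :: 'a
    have 1: "(\<Sum>b\<in>Basis. (x \<bullet> b) * (u \<bullet> T (V' x b))) = u \<bullet> T (V' x x)" for u
      by (subst linear_Basis_expand[OF lin1, of x x])
         (simp add: linear_sum[OF T_linear] linear_cmul[OF T_linear] inner_sum_right)
    have "(\<Sum>b\<in>Basis. (x \<bullet> b) * Z b x) =
      W x \<bullet> T (V' x x) - (\<Sum>b\<in>Basis. (x \<bullet> b) * (x \<bullet> b)) * (energy x / 2 + P (V x)) + c * (V x \<bullet> T (V' x x))"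
      unfolding Z_def 1[symmetric]
      by (simp add: ring_distribs sum.distrib sum_subtractf sum_distrib_left sum_distrib_right ac_simps)
    then have 2: "(\<Sum>b\<in>Basis. (x \<bullet> b) * Z b x) =
      V' x x \<bullet> T (V' x x) - (x \<bullet> x) * (energy x / 2 + P (V x)) + c * (V x \<bullet> T (V' x x))"
      by (simp add: W euclidean_inner[of x x])
    have "(\<Sum>b\<in>Basis. g (x \<bullet> x) * Z' b x b + \<phi>' x b * Z b x) =
      g (x \<bullet> x) * (\<Sum>b\<in>Basis. Z' b x b) - 2 * k (x \<bullet> x) * (\<Sum>b\<in>Basis. (x \<bullet> b) * Z b x)"
      by (simp add: \<phi>'_def sum.distrib sum_subtractf sum_distrib_left sum_negf mult.assoc mult.left_commute)
    then show "(\<Sum>b\<in>Basis. g (x \<bullet> x) * Z' b x b + \<phi>' x b * Z b x) =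
     (1 - real DIM('a) / 2 + c) * (g (x \<bullet> x) * energy x) - 2 * k (x \<bullet> x) *
      (V' x x \<bullet> T (V' x x) - (x \<bullet> x) * (energy x / 2 + P (V x)) + c * (V x \<bullet> T (V' x x)))"
      unfolding 2 div by simp
  qed
  also have "integral (cbox lo hi) \<dots> =
    (1 - real DIM('a) / 2 + c) * integral (cbox lo hi) (\<lambda>x. g (x \<bullet> x) * energy x) -
    integral (cbox lo hi) (\<lambda>x. 2 * k (x \<bullet> x) *
      (V' x x \<bullet> T (V' x x) - (x \<bullet> x) * (energy x / 2 + P (V x)) + c * (V x \<bullet> T (V' x x))))"
    unfolding integral_mult_right[symmetric] W[symmetric] W_def
    by (intro integral_diff integrable_continuous continuous_intros c\<phi> V_cont) simp
  finally show ?thesis by simp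
qed

text \<open>
  Test the equation for \<open>lap Q''\<close> with the cutoff \<open>h (x \<bullet> x / R\<^sup>2)\<close>. By Green's identity both derivatives fall on the
  cutoff and cost a factor \<open>R\<^sup>2\<close>; so the energy is controlled without derivatives of \<open>V\<close>.
\<close>

lemma annular_energy_bound:
  assumes h: "\<And>s. (h has_real_derivative h' s) (at s)" "\<And>s. (h' has_real_derivative h'' s) (at s)"
    and h'': "continuous_on UNIV h''"
    and supp_h: "\<forall>s. s \<le> 1 \<or> 4 \<le> s \<longrightarrow> h s = 0 \<and> h' s = 0 \<and> h'' s = 0"
  shows "\<exists>C\<ge>0. \<forall>R D. 0 < R \<longrightarrow>
    (\<forall>x. R \<le> norm x \<longrightarrow> norm x \<le> 2 * R \<longrightarrow> Q x \<le> D * R\<^sup>2 \<and> \<bar>P (V x)\<bar> \<le> D) \<longrightarrow> 0 \<le> D \<longrightarrow>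
    integral (cube 0 (2 * R)) (\<lambda>x. h (x \<bullet> x / R\<^sup>2) * energy x) \<le> C * D * R ^ DIM('a)"
proof -
  let ?n = "real DIM('a)"
  note hz = supp_h[rule_format]
  have ch: "continuous_on UNIV h" by (rule DERIV_continuous_on[OF DERIV_subset[OF h(1)]]) auto
  have ch': "continuous_on UNIV h'" by (rule DERIV_continuous_on[OF DERIV_subset[OF h(2)]]) auto
  obtain N where N: "0 \<le> N" "\<And>s. \<bar>h s\<bar> \<le> N"
    by (rule bounded_of_support[OF ch, of 1 4]) (use hz in auto)
  obtain M where M: "0 \<le> M" "\<And>s. \<bar>4 * s * h'' s + 2 * ?n * h' s\<bar> \<le> M"
    by (rule bounded_of_support[of "\<lambda>s. 4 * s * h'' s + 2 * ?n * h' s" 1 4])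
       (use hz in \<open>auto intro!: continuous_intros h'' ch'\<close>)
  define C where "C = (M / 2 + (q + 1) * N) * 4 ^ DIM('a)"
  have "0 \<le> C" using M N q_gt_1 by (simp add: C_def)
  moreover have "integral (cube 0 (2 * R)) (\<lambda>x. h (x \<bullet> x / R\<^sup>2) * energy x) \<le> C * D * R ^ DIM('a)"
    if R: "0 < R" and D: "0 \<le> D"
      and b: "\<And>x. R \<le> norm x \<Longrightarrow> norm x \<le> 2 * R \<Longrightarrow> Q x \<le> D * R\<^sup>2 \<and> \<bar>P (V x)\<bar> \<le> D" for R D
  proof -
    let ?B = "cube (0::'a) (2 * R)"
    define H where "H x = h (x \<bullet> x / R\<^sup>2)" for x :: 'a
    define H'' where "H'' x u v = h'' (x \<bullet> x / R\<^sup>2) * (2 * (x \<bullet> v) / R\<^sup>2) * (2 * (x \<bullet> u) / R\<^sup>2)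
      + h' (x \<bullet> x / R\<^sup>2) * (2 * (u \<bullet> v) / R\<^sup>2)" for x u v :: 'a
    have H: "C2_deriv H (\<lambda>x v. h' (x \<bullet> x / R\<^sup>2) * (2 * (x \<bullet> v) / R\<^sup>2)) H''"
      unfolding H_def[abs_def] H''_def[abs_def] by (rule C2_deriv_radial[OF h h'']) (use R in simp)
    have annulus: "R \<le> norm x \<and> norm x \<le> 2 * R" if "\<not> (x \<bullet> x / R\<^sup>2 \<le> 1 \<or> 4 \<le> x \<bullet> x / R\<^sup>2)" for x :: 'a
    proof -
      have "R\<^sup>2 \<le> (norm x)\<^sup>2" "(norm x)\<^sup>2 \<le> (2 * R)\<^sup>2"
        using that R by (auto simp: dot_square_norm field_simps)
      then show ?thesis using R by (auto intro: power2_le_imp_le)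
    qed
    have supp: "H x = 0" if "x \<notin> ?B" for x
    proof (rule ccontr)
      assume "H x \<noteq> 0"
      then have "norm x \<le> 2 * R" using annulus[of x] hz[of "x \<bullet> x / R\<^sup>2"] by (auto simp: H_def)
      then have "x \<in> ?B" by (rule in_cube_0)
      then show False using that by simp
    qed
    have lapH: "lap H'' x = (4 * (x \<bullet> x / R\<^sup>2) * h'' (x \<bullet> x / R\<^sup>2) + 2 * ?n * h' (x \<bullet> x / R\<^sup>2)) / R\<^sup>2" for x
    proof -
      have "lap H'' x = (\<Sum>b\<in>Basis. 4 * h'' (x \<bullet> x / R\<^sup>2) / R\<^sup>2 / R\<^sup>2 * ((x \<bullet> b) * (x \<bullet> b)) + 2 * h' (x \<bullet> x / R\<^sup>2) / R\<^sup>2)"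
        unfolding lap_def H''_def by (intro sum.cong refl) (simp add: divide_inverse ac_simps)
      also have "\<dots> = 4 * h'' (x \<bullet> x / R\<^sup>2) / R\<^sup>2 / R\<^sup>2 * (x \<bullet> x) + ?n * (2 * h' (x \<bullet> x / R\<^sup>2) / R\<^sup>2)"
        by (simp only: sum.distrib sum_distrib_left[symmetric] euclidean_inner[of x x, symmetric]) simp
      finally show ?thesis by (simp add: add_divide_distrib mult.commute mult.left_commute)
    qed
    have cH: "continuous_on S H" for S by (rule C2_deriv_cont0[OF H])
    have vol: "measure lborel ?B = 4 ^ DIM('a) * R ^ DIM('a)"
      using R measure_cube[of "2 * R" "0::'a"] power_mult_distrib[of 4 R "DIM('a)"] by simp
    have "2 * integral ?B (\<lambda>x. H x * energy x) + 2 * (q + 1) * integral ?B (\<lambda>x. H x * P (V x)) =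
      integral ?B (\<lambda>x. H x * lap Q'' x)"
    proof -
      have "integral ?B (\<lambda>x. H x * lap Q'' x) =
        integral ?B (\<lambda>x. 2 * (H x * energy x) + 2 * (q + 1) * (H x * P (V x)))"
        by (simp add: lap_Q algebra_simps)
      also have "\<dots> = integral ?B (\<lambda>x. 2 * (H x * energy x)) + integral ?B (\<lambda>x. 2 * (q + 1) * (H x * P (V x)))"
        by (intro integral_add integrable_continuous continuous_intros cH)
      finally show ?thesis by simp
    qed
    also have "\<dots> = integral ?B (\<lambda>x. Q x * lap H'' x)"
      by (rule integral_Green_identity[OF Q_C2 H supp])
    also have "\<dots> \<le> integral ?B (\<lambda>x. D * M)"
    proof (rule integral_le)
      fix x
      show "Q x * lap H'' x \<le> D * M"
      proof (cases "x \<bullet> x / R\<^sup>2 \<le> 1 \<or> 4 \<le> x \<bullet> x / R\<^sup>2")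
        case True
        then show ?thesis unfolding lapH using hz[OF True] D M by simp
      next
        case False
        have "Q x * lap H'' x \<le> Q x * (M / R\<^sup>2)"
          unfolding lapH using M(2)[of "x \<bullet> x / R\<^sup>2"] R Q_nonneg
          by (intro mult_left_mono divide_right_mono) auto
        also have "\<dots> \<le> (D * R\<^sup>2) * (M / R\<^sup>2)"
          using b annulus[OF False] M by (intro mult_right_mono) auto
        finally show ?thesis using R by simp
      qed
    qed (auto intro!: integrable_continuous continuous_intros C2_deriv_cont0[OF Q_C2] continuous_on_lap[OF H])
    also have "\<dots> = D * M * measure lborel ?B" by simp
    finally have 1: "2 * integral ?B (\<lambda>x. H x * energy x) \<le> D * M * measure lborel ?B - 2 * (q + 1) * integral ?B (\<lambda>x. H x * P (V x))"
      by simp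
    have "integral ?B (\<lambda>x. - (N * D)) \<le> integral ?B (\<lambda>x. H x * P (V x))"
    proof (rule integral_le)
      fix x
      show "- (N * D) \<le> H x * P (V x)"
      proof (cases "x \<bullet> x / R\<^sup>2 \<le> 1 \<or> 4 \<le> x \<bullet> x / R\<^sup>2")
        case True
        then show ?thesis using hz[OF True] N D by (simp add: H_def)
      next
        case False
        have "\<bar>H x\<bar> * \<bar>P (V x)\<bar> \<le> N * D"
          using N b annulus[OF False] by (intro mult_mono) (auto simp: H_def)
        then show ?thesis by (simp add: abs_mult[symmetric] abs_le_iff)
      qed
    qed (auto intro!: integrable_continuous continuous_intros cH)
    then have 2: "- (N * D) * measure lborel ?B \<le> integral ?B (\<lambda>x. H x * P (V x))"
      by (simp add: ac_simps)
    have "2 * (q + 1) * (- (N * D) * measure lborel ?B) \<le> 2 * (q + 1) * integral ?B (\<lambda>x. H x * P (V x))"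
      using q_gt_1 by (intro mult_left_mono 2) auto
    with 1 have "2 * integral ?B (\<lambda>x. H x * energy x) \<le>
        D * M * measure lborel ?B - 2 * (q + 1) * (- (N * D) * measure lborel ?B)"
      by linarith
    also have "\<dots> = 2 * (C * D * R ^ DIM('a))"
      unfolding vol C_def by (simp add: algebra_simps)
    finally show ?thesis unfolding H_def by linarith
  qed
  ultimately show ?thesis by blast
qed

text \<open>
  In the Pohozaev identity with the cutoff \<open>G (x \<bullet> x / R\<^sup>2)\<close> the right-hand side lives on the annulus, where
  \<open>norm x\<close> is comparable to \<open>R\<close>. It is bounded pointwise by the energy, \<open>Q / R\<^sup>2\<close> and \<open>\<bar>P (V x)\<bar>\<close> with weight \<open>h\<close>, and
  the energy with this weight has just been estimated. The factor \<open>DIM('a)\<close> makes the small cube fit into the ball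
  of radius \<open>R\<close>.
\<close>

lemma energy_bound:
  assumes crit: "1 - real DIM('a) / 2 + real DIM('a) / (q + 1) \<noteq> 0"
  shows "\<exists>C\<ge>0. \<forall>R D. 0 < R \<longrightarrow>
    (\<forall>x. R \<le> norm x \<longrightarrow> norm x \<le> 2 * R \<longrightarrow> Q x \<le> D * R\<^sup>2 \<and> \<bar>P (V x)\<bar> \<le> D) \<longrightarrow> 0 \<le> D \<longrightarrow>
    (\<forall>r\<ge>0. real DIM('a) * r \<le> R \<longrightarrow> integral (cube 0 r) energy \<le> C * D * R ^ DIM('a))"
proof -
  define c where "c = real DIM('a) / (q + 1)"
  define \<kappa> where "\<kappa> = \<bar>1 - real DIM('a) / 2 + c\<bar>"
  have c0: "0 \<le> c" using q_gt_1 by (simp add: c_def)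
  have \<kappa>: "0 < \<kappa>" using crit by (simp add: \<kappa>_def c_def)
  obtain h h' h'' G :: "real \<Rightarrow> real" and g0
    where h: "\<And>s. (h has_real_derivative h' s) (at s)" "\<And>s. (h' has_real_derivative h'' s) (at s)"
    and h'': "continuous_on UNIV h''" and h0: "\<And>s. 0 \<le> h s"
    and hz: "\<And>s. s \<le> 1 \<or> 4 \<le> s \<Longrightarrow> h s = 0 \<and> h' s = 0 \<and> h'' s = 0"
    and G: "\<And>s. 0 \<le> s \<Longrightarrow> (G has_real_derivative - h s) (at s)"
    and G4: "\<And>s. 4 \<le> s \<Longrightarrow> G s = 0" and G0: "\<And>s. 0 \<le> s \<Longrightarrow> 0 \<le> G s"
    and g0: "0 < g0" and G1: "\<And>s. 0 \<le> s \<Longrightarrow> s \<le> 1 \<Longrightarrow> G s = g0"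
    by (rule annular_cutoff) (rule that; assumption)
  have ch: "continuous_on UNIV h" by (rule DERIV_continuous_on[OF DERIV_subset[OF h(1)]]) auto
  obtain N where N: "0 \<le> N" "\<And>s. \<bar>h s\<bar> \<le> N"
    by (rule bounded_of_support[OF ch, of 1 4]) (use hz in auto)
  have supp_h: "\<forall>s. s \<le> 1 \<or> 4 \<le> s \<longrightarrow> h s = 0 \<and> h' s = 0 \<and> h'' s = 0"
    using hz by blast
  obtain C1 where C1: "0 \<le> C1" and
    ann: "\<forall>R D. 0 < R \<longrightarrow>
      (\<forall>x. R \<le> norm x \<longrightarrow> norm x \<le> 2 * R \<longrightarrow> Q x \<le> D * R\<^sup>2 \<and> \<bar>P (V x)\<bar> \<le> D) \<longrightarrow> 0 \<le> D \<longrightarrow>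
      integral (cube 0 (2 * R)) (\<lambda>x. h (x \<bullet> x / R\<^sup>2) * energy x) \<le> C1 * D * R ^ DIM('a)"
    using annular_energy_bound[OF h h'' supp_h] by (elim exE conjE) (rule that)
  define A B where "A = 12 + 4 * c" and "B = (8 + c) * N * 4 ^ DIM('a)"
  have A: "0 \<le> A" and B: "0 \<le> B" using c0 N by (auto simp: A_def B_def)
  define C where "C = (A * C1 + B) / (\<kappa> * g0)"
  have "0 \<le> C" using A B C1 \<kappa> g0 by (simp add: C_def)
  moreover have "integral (cube 0 r) energy \<le> C * D * R ^ DIM('a)"
    if R: "0 < R" and D: "0 \<le> D" and r: "0 \<le> r" "real DIM('a) * r \<le> R"
      and b: "\<And>x. R \<le> norm x \<Longrightarrow> norm x \<le> 2 * R \<Longrightarrow> Q x \<le> D * R\<^sup>2 \<and> \<bar>P (V x)\<bar> \<le> D" for R D r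
  proof -
    let ?B = "cube (0::'a) (2 * R)"
    define g k where "g s = G (s / R\<^sup>2)" and "k s = h (s / R\<^sup>2) / R\<^sup>2" for s
    have dg: "(g has_real_derivative - k s) (at s)" if "0 \<le> s" for s
    proof -
      have "((\<lambda>s. s / R\<^sup>2) has_real_derivative 1 / R\<^sup>2) (at s)"
        by (rule DERIV_cdivide[OF DERIV_ident])
      from DERIV_chain2[OF G this] show ?thesis using that by (simp add: g_def[abs_def] k_def)
    qed
    have ck: "continuous_on UNIV k"
      unfolding k_def by (intro continuous_intros continuous_on_compose2[OF ch]) (use R in auto)
    have annulus: "R \<le> norm x \<and> norm x \<le> 2 * R \<and> x \<bullet> x \<le> 4 * R\<^sup>2" if "\<not> (x \<bullet> x / R\<^sup>2 \<le> 1 \<or> 4 \<le> x \<bullet> x / R\<^sup>2)" for x :: 'a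
    proof -
      have "R\<^sup>2 \<le> (norm x)\<^sup>2" "(norm x)\<^sup>2 \<le> (2 * R)\<^sup>2"
        using that R by (auto simp: dot_square_norm field_simps)
      then show ?thesis using R by (auto intro: power2_le_imp_le simp: dot_square_norm)
    qed
    have supp: "g (x \<bullet> x) = 0" if "x \<notin> ?B" for x :: 'a
    proof -
      have "\<not> norm x \<le> 2 * R"
      proof
        assume "norm x \<le> 2 * R"
        then have "x \<in> ?B" by (rule in_cube_0)
        then show False using that by simp
      qed
      then have "(2 * R)\<^sup>2 \<le> (norm x)\<^sup>2" using R by (intro power_mono) auto
      then show ?thesis unfolding g_def using R by (intro G4) (simp add: dot_square_norm field_simps)
    qed
    have cg: "continuous_on S (\<lambda>x::'a. g (x \<bullet> x))" for S
      by (rule has_derivative_continuous_on[OF has_derivative_at_withinI[OF has_derivative_radial[OF dg]]]) simp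
    have cE: "continuous_on S (\<lambda>x::'a. h (x \<bullet> x / R\<^sup>2) * energy x)" for S
      by (intro continuous_intros continuous_on_compose2[OF ch]) (use R in auto)
    define bdry where "bdry x = 2 * k (x \<bullet> x) *
      (V' x x \<bullet> T (V' x x) - (x \<bullet> x) * (energy x / 2 + P (V x)) + c * (V x \<bullet> T (V' x x)))" for x
    have bdry: "\<bar>bdry x\<bar> \<le> A * (h (x \<bullet> x / R\<^sup>2) * energy x) + (8 + c) * N * D" for x
    proof (cases "x \<bullet> x / R\<^sup>2 \<le> 1 \<or> 4 \<le> x \<bullet> x / R\<^sup>2")
      case True
      then show ?thesis using hz[OF True] N D c0 by (simp add: bdry_def k_def)
    next
      case False
      note x = annulus[OF False]
      let ?w = "V' x x \<bullet> T (V' x x)"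
      let ?h = "h (x \<bullet> x / R\<^sup>2)"
      have e: "0 \<le> energy x" by (rule energy_nonneg)
      have xe: "(x \<bullet> x) * energy x \<le> 4 * R\<^sup>2 * energy x" using x e by (intro mult_right_mono) auto
      have w: "0 \<le> ?w" "?w \<le> (x \<bullet> x) * energy x" by (rule T_nonneg, rule radial_derivative_le)
      have QP: "Q x \<le> D * R\<^sup>2" "\<bar>P (V x)\<bar> \<le> D" using b x by auto
      have "\<bar>(x \<bullet> x) * P (V x)\<bar> \<le> 4 * R\<^sup>2 * D"
        unfolding abs_mult using x QP by (intro mult_mono) auto
      moreover have "\<bar>c * (V x \<bullet> T (V' x x))\<bar> \<le> c * ((D * R\<^sup>2 + 4 * R\<^sup>2 * energy x) / 2)"
        unfolding abs_mult using c0 T_AM_GM[of "V x" "V' x x"] w xe QP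
        by (intro mult_mono) (auto simp: Q_def)
      moreover have "0 \<le> R\<^sup>2 * energy x" using e by simp
      ultimately have "\<bar>?w - (x \<bullet> x) * (energy x / 2 + P (V x)) + c * (V x \<bullet> T (V' x x))\<bar> \<le>
        6 * (R\<^sup>2 * energy x) + 4 * R\<^sup>2 * D + c * ((D * R\<^sup>2 + 4 * R\<^sup>2 * energy x) / 2)"
        using w xe unfolding distrib_left abs_le_iff by (auto simp: mult.assoc)
      also have "\<dots> = R\<^sup>2 * ((6 + 2 * c) * energy x + (4 + c / 2) * D)"
        by (simp add: algebra_simps)
      finally have "\<bar>bdry x\<bar> \<le> 2 * k (x \<bullet> x) * (R\<^sup>2 * ((6 + 2 * c) * energy x + (4 + c / 2) * D))"
        unfolding bdry_def abs_mult using h0[of "x \<bullet> x / R\<^sup>2"]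
        by (intro mult_mono) (auto simp: k_def)
      also have "\<dots> = A * (?h * energy x) + (8 + c) * ?h * D"
        using R by (simp add: k_def A_def algebra_simps)
      also have "\<dots> \<le> A * (?h * energy x) + (8 + c) * N * D"
        using N(2)[of "x \<bullet> x / R\<^sup>2"] c0 D by (intro add_left_mono mult_right_mono mult_left_mono) auto
      finally show ?thesis .
    qed
    have cb: "continuous_on S bdry" for S
      unfolding bdry_def[abs_def]
    proof -
      have "V' x x = (\<Sum>j\<in>Basis. (x \<bullet> j) *\<^sub>R V' x j)" for x
        by (rule linear_Basis_expand[OF C2_deriv_linear1[OF V_C2]])
      then have W: "continuous_on S (\<lambda>x. V' x x)"
        by (simp only:) (intro continuous_intros V_cont)
      have "continuous_on S (\<lambda>x::'a. k (x \<bullet> x))"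
        by (intro continuous_on_compose2[OF ck] continuous_intros) auto
      then show "continuous_on S (\<lambda>x. 2 * k (x \<bullet> x) *
          (V' x x \<bullet> T (V' x x) - (x \<bullet> x) * (energy x / 2 + P (V x)) + c * (V x \<bullet> T (V' x x))))"
        by (intro continuous_intros W V_cont) auto
    qed
    have sub1: "norm x \<le> R" if "x \<in> cube 0 r" for x :: 'a
      using norm_diff_le_in_cube[OF that] r by simp
    have sub2: "cube (0::'a) r \<subseteq> ?B"
    proof -
      have "1 * r \<le> real DIM('a) * r"
        using r DIM_positive[where 'a='a] by (intro mult_right_mono) auto
      then have "r \<le> 2 * R" using r R by linarith
      then show ?thesis by (force simp only: mem_cube)
    qed
    have ge: "0 \<le> g (x \<bullet> x) * energy x" for x :: 'a
      unfolding g_def by (intro mult_nonneg_nonneg G0 energy_nonneg) auto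
    have "g0 * integral (cube 0 r) energy = integral (cube 0 r) (\<lambda>x. g (x \<bullet> x) * energy x)"
    proof -
      have "integral (cube 0 r) (\<lambda>x. g (x \<bullet> x) * energy x) = integral (cube 0 r) (\<lambda>x. g0 * energy x)"
      proof (rule integral_cong)
        fix x :: 'a assume "x \<in> cube 0 r"
        then have "(norm x)\<^sup>2 \<le> R\<^sup>2" using sub1 by (intro power_mono) auto
        then show "g (x \<bullet> x) * energy x = g0 * energy x"
          unfolding g_def using R by (subst G1) (auto simp: dot_square_norm field_simps)
      qed
      then show ?thesis by simp
    qed
    also have "\<dots> \<le> integral ?B (\<lambda>x. g (x \<bullet> x) * energy x)"
      using sub2 by (intro integral_subset_le integrable_continuous continuous_intros cg ballI ge) auto
    finally have "\<kappa> * (g0 * integral (cube 0 r) energy) \<le> \<kappa> * integral ?B (\<lambda>x. g (x \<bullet> x) * energy x)"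
      using \<kappa> by (intro mult_left_mono) auto
    also have "\<dots> = \<bar>(1 - real DIM('a) / 2 + c) * integral ?B (\<lambda>x. g (x \<bullet> x) * energy x)\<bar>"
    proof -
      have "0 \<le> integral ?B (\<lambda>x. g (x \<bullet> x) * energy x)"
        by (intro integral_nonneg integrable_continuous continuous_intros cg ge)
      then show ?thesis by (simp add: abs_mult \<kappa>_def)
    qed
    also have "(1 - real DIM('a) / 2 + c) * integral ?B (\<lambda>x. g (x \<bullet> x) * energy x) = integral ?B bdry"
      unfolding bdry_def[abs_def] by (rule Pohozaev_identity[OF dg ck supp c_def])
    also have "\<bar>integral ?B bdry\<bar> \<le> integral ?B (\<lambda>x. A * (h (x \<bullet> x / R\<^sup>2) * energy x) + (8 + c) * N * D)"
      using bdry unfolding real_norm_def[symmetric]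
      by (intro Henstock_Kurzweil_Integration.integral_norm_bound_integral integrable_continuous
          continuous_on_add continuous_on_mult continuous_on_const cE cb)
    also have "\<dots> = A * integral ?B (\<lambda>x. h (x \<bullet> x / R\<^sup>2) * energy x) + (8 + c) * N * D * measure lborel ?B"
      by (subst integral_add) (auto intro!: integrable_continuous continuous_on_mult_left cE)
    also have "\<dots> \<le> A * (C1 * D * R ^ DIM('a)) + (8 + c) * N * D * measure lborel ?B"
      using A by (intro add_right_mono mult_left_mono ann[rule_format] R D b) auto
    also have "measure lborel ?B = 4 ^ DIM('a) * R ^ DIM('a)"
      using R measure_cube[of "2 * R" "0::'a"] power_mult_distrib[of 4 R "DIM('a)"] by simp
    finally have "\<kappa> * g0 * integral (cube 0 r) energy \<le> (A * C1 + B) * D * R ^ DIM('a)"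
      by (simp add: B_def algebra_simps)
    then show ?thesis using \<kappa> g0 by (simp add: C_def field_simps)
  qed
  ultimately show ?thesis by blast
qed

text \<open>
  Under the decay hypotheses the constant \<open>D\<close> of the energy bound can be taken of order \<open>R\<^bsup>-2\<gamma>-2\<^esup>\<close>,
  so the energy of a fixed cube is \<open>O(R\<^bsup>n-2-2\<gamma>\<^esup>)\<close> as \<open>R \<rightarrow> \<infinity>\<close>. It vanishes, \<open>V\<close> is constant, and the decay of
  \<open>Q\<close> leaves only the constant \<open>0\<close>.
\<close>

lemma trivial_if_fast_decay:
  assumes crit: "1 - real DIM('a) / 2 + real DIM('a) / (q + 1) \<noteq> 0"
    and \<gamma>: "0 < \<gamma>" "real DIM('a) - 2 < 2 * \<gamma>"
    and R0: "0 < R0"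
    and decay: "\<And>x. R0 \<le> norm x \<Longrightarrow> Q x \<le> C0 * norm x powr (- 2 * \<gamma>)"
    and scaling: "\<And>x. R0 \<le> norm x \<Longrightarrow> (norm x)\<^sup>2 * Q x powr ((q - 1) / 2) \<le> 1"
  shows "V x = 0"
proof -
  let ?n = "real DIM('a)"
  have C0: "0 \<le> C0"
  proof -
    obtain z :: 'a where z: "norm z = R0" using vector_choose_size[of R0] R0 by auto
    then have "0 \<le> C0 * R0 powr (- 2 * \<gamma>)" using decay[of z] Q_nonneg[of z] by simp
    then show ?thesis using R0 by (simp add: zero_le_mult_iff)
  qed
  obtain K where K: "0 \<le> K" "\<And>v. \<bar>P v\<bar> \<le> K * (v \<bullet> T v) powr ((q + 1) / 2)"
    using P_bound by auto
  obtain C where C: "0 \<le> C" and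
    bound: "\<forall>R D. 0 < R \<longrightarrow>
    (\<forall>x. R \<le> norm x \<longrightarrow> norm x \<le> 2 * R \<longrightarrow> Q x \<le> D * R\<^sup>2 \<and> \<bar>P (V x)\<bar> \<le> D) \<longrightarrow> 0 \<le> D \<longrightarrow>
    (\<forall>r\<ge>0. ?n * r \<le> R \<longrightarrow> integral (cube 0 r) energy \<le> C * D * R ^ DIM('a))"
    using energy_bound[OF crit] by (elim exE conjE) (rule that)
  define B where "B = C * ((1 + K) * C0)"
  have int: "integral (cube 0 r) energy \<le> B * R powr (?n - 2 - 2 * \<gamma>)"
    if r: "0 \<le> r" and R: "R0 \<le> R" "?n * r \<le> R" for r R
  proof -
    have R': "0 < R" using R R0 by linarith
    define D where "D = (1 + K) * C0 * R powr (- 2 * \<gamma>) / R\<^sup>2"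
    have D: "0 \<le> D" using K C0 by (simp add: D_def)
    have "Q x \<le> D * R\<^sup>2 \<and> \<bar>P (V x)\<bar> \<le> D" if x: "R \<le> norm x" for x
    proof -
      have "norm x powr (- 2 * \<gamma>) \<le> R powr (- 2 * \<gamma>)"
        using R' x \<gamma> by (intro powr_mono2') auto
      then have Q1: "Q x \<le> C0 * R powr (- 2 * \<gamma>)"
        using decay[of x] C0 x R mult_left_mono[of "norm x powr (- 2 * \<gamma>)" "R powr (- 2 * \<gamma>)" C0] by linarith
      have "R\<^sup>2 * Q x powr ((q - 1) / 2) \<le> (norm x)\<^sup>2 * Q x powr ((q - 1) / 2)"
        using x R' by (intro mult_right_mono power_mono) auto
      then have Q2: "Q x powr ((q - 1) / 2) \<le> 1 / R\<^sup>2"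
        using scaling[of x] x R R' by (simp add: field_simps)
      have "Q x powr ((q + 1) / 2) = Q x * Q x powr ((q - 1) / 2)"
      proof (cases "Q x = 0")
        case False
        then have "0 < Q x" using Q_nonneg[of x] by simp
        moreover have e: "(q + 1) / 2 = 1 + (q - 1) / 2" by (simp add: field_simps)
        ultimately show ?thesis unfolding e powr_add by simp
      qed simp
      also have "\<dots> \<le> (C0 * R powr (- 2 * \<gamma>)) * (1 / R\<^sup>2)"
        using Q1 Q2 Q_nonneg[of x] by (intro mult_mono) auto
      finally have "K * Q x powr ((q + 1) / 2) \<le> K * (C0 * R powr (- 2 * \<gamma>) / R\<^sup>2)"
        using K by (intro mult_left_mono) auto
      moreover have "0 \<le> C0 * R powr (- 2 * \<gamma>) / R\<^sup>2" using C0 by simp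
      ultimately have "\<bar>P (V x)\<bar> \<le> D"
        using K(2)[of "V x"] by (simp add: Q_def[symmetric] D_def algebra_simps add_divide_distrib)
      moreover have "Q x \<le> D * R\<^sup>2"
      proof -
        have "D * R\<^sup>2 = (1 + K) * C0 * R powr (- 2 * \<gamma>)"
          using R' by (simp add: D_def)
        also have "\<dots> = (C0 * R powr (- 2 * \<gamma>)) + K * (C0 * R powr (- 2 * \<gamma>))"
          by (simp add: algebra_simps)
        finally have "D * R\<^sup>2 = (C0 * R powr (- 2 * \<gamma>)) + K * (C0 * R powr (- 2 * \<gamma>))" .
        moreover have "0 \<le> K * (C0 * R powr (- 2 * \<gamma>))" using K C0 by simp
        ultimately show ?thesis using Q1 by linarith
      qed
      ultimately show ?thesis by simp
    qed
    then have "integral (cube 0 r) energy \<le> C * D * R ^ DIM('a)"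
      using bound R' D r R by blast
    also have "\<dots> = B * (R powr (- 2 * \<gamma>) / R powr 2 * R powr ?n)"
      using R' by (simp add: B_def D_def powr_realpow)
    also have "R powr (- 2 * \<gamma>) / R powr 2 * R powr ?n = R powr (?n - 2 - 2 * \<gamma>)"
      by (simp only: powr_diff[symmetric] powr_add[symmetric]) (simp add: algebra_simps)
    finally show ?thesis .
  qed
  have lim: "((\<lambda>R. k * R powr (- e)) \<longlongrightarrow> 0) at_top" if "0 < e" for e k :: real
    using tendsto_mult_right_zero[OF tendsto_neg_powr[of "- e" "\<lambda>R. R" at_top]] that
    by (auto simp: filterlim_ident)
  have energy_0: "energy x = 0" for x
  proof -
    define r where "r = norm x + 1"
    have r: "0 < r" by (simp add: r_def add_nonneg_pos)
    have "integral (cube 0 r) energy \<le> 0"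
    proof (rule tendsto_lowerbound[OF lim[of "2 * \<gamma> - (?n - 2)" B]])
      have "\<forall>\<^sub>F R in at_top. R0 \<le> R \<and> ?n * r \<le> R"
        by (intro eventually_conj eventually_ge_at_top)
      then show "\<forall>\<^sub>F R in at_top. integral (cube 0 r) energy \<le> B * R powr (- (2 * \<gamma> - (?n - 2)))"
      proof eventually_elim
        case (elim R)
        then show ?case using int[of r R] r by (simp add: algebra_simps)
      qed
    qed (use \<gamma> in auto)
    moreover have "0 \<le> integral (cube (0::'a) r) energy"
      by (intro integral_nonneg integrable_continuous continuous_intros energy_nonneg)
    ultimately have "(energy has_integral 0) (cube 0 r)"
      by (metis antisym integrable_continuous integrable_integral continuous_on_energy)
    moreover have "box (0 - r *\<^sub>R One) (0 + r *\<^sub>R One :: 'a) \<noteq> {}"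
      using r by (simp add: box_ne_empty inner_simps)
    moreover have "x \<in> cube 0 r" by (rule in_cube_0) (simp add: r_def)
    ultimately show ?thesis
      using has_integral_0_cbox_imp_0[OF continuous_on_energy energy_nonneg] by blast
  qed
  have "V' x b = 0" if "b \<in> Basis" for x b
    using energy_0[of x] that T_pos[of "V' x b"] T_nonneg
    by (force simp: energy_def sum_nonneg_eq_0_iff)
  then have "V' x = (\<lambda>v. 0)" for x
    by (intro ext, subst linear_Basis_expand[OF C2_deriv_linear1[OF V_C2]]) simp
  then have "\<exists>c. \<forall>x\<in>UNIV. V x = c"
    by (intro has_derivative_zero_constant) (use V_D1 in auto)
  then obtain v where v: "\<And>x. V x = v" by auto
  have "v \<bullet> T v \<le> 0"
  proof (rule tendsto_lowerbound[OF lim[of "2 * \<gamma>" C0]])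
    show "\<forall>\<^sub>F R in at_top. v \<bullet> T v \<le> C0 * R powr - (2 * \<gamma>)"
      using eventually_ge_at_top[of R0]
    proof eventually_elim
      case (elim R)
      then obtain z :: 'a where "norm z = R" using vector_choose_size[of R] R0 by auto
      then show ?case using decay[of z] elim v by (simp add: Q_def)
    qed
  qed (use \<gamma> in auto)
  then show ?thesis using T_pos[of v] v by force
qed

text \<open>
  The scale invariant decay \<open>Q = O(\<bar>x\<bar>\<^bsup>-2/s\<^esup>)\<close> already suffices below the critical exponent. Above it,
  the scale invariant decay with a small constant makes the potential \<open>Q powr s\<close> a small multiple of \<open>\<bar>x\<bar>\<^bsup>-2\<^esup>\<close>, and
  comparison with the conjugate exponent \<open>\<beta> = n - 2 - 1 / s\<close> gives the decay that is needed.
\<close>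

theorem trivial_if_integrable:
  assumes dim: "3 \<le> DIM('a)"
    and noncrit: "q \<noteq> (real DIM('a) + 2) / (real DIM('a) - 2)"
    and int: "(\<lambda>x. Q x powr (real DIM('a) * ((q - 1) / 2) / 2)) integrable_on UNIV"
  shows "V x = 0"
proof -
  let ?n = "real DIM('a)"
  define s where "s = (q - 1) / 2"
  have s: "0 < s" using q_gt_1 by (simp add: s_def)
  have n: "3 \<le> ?n" using dim by simp
  have q: "q = 2 * s + 1" by (simp add: s_def field_simps)
  obtain K0 where K0: "0 \<le> K0" "\<And>v. \<bar>P v\<bar> \<le> K0 * (v \<bullet> T v) powr ((q + 1) / 2)"
    using P_bound by auto
  define K where "K = 2 * (q + 1) * K0"
  have K: "0 \<le> K" using K0 q_gt_1 by (simp add: K_def)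
  have P_ge: "- K * Q x powr (1 + s) \<le> 2 * (q + 1) * P (V x)" for x
  proof -
    have e: "(q + 1) / 2 = 1 + s" by (simp add: s_def field_simps)
    have "- (K0 * Q x powr (1 + s)) \<le> P (V x)"
      using K0(2)[of "V x", unfolded e] by (simp add: Q_def abs_le_iff)
    then have "2 * (q + 1) * - (K0 * Q x powr (1 + s)) \<le> 2 * (q + 1) * P (V x)"
      using q_gt_1 by (intro mult_left_mono) auto
    then show ?thesis by (simp add: K_def mult.assoc)
  qed
  have sub: "- K * Q x powr (1 + s) \<le> lap Q'' x" for x
    using P_ge[of x] energy_nonneg[of x] by (simp add: lap_Q)
  have decay: "\<exists>R>0. \<forall>x. R \<le> norm x \<longrightarrow> (norm x)\<^sup>2 * Q x powr s \<le> \<delta>" if "0 < \<delta>" for \<delta>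
    using scale_invariant_decay[OF s K that Q_C2 Q_nonneg sub] int by (simp add: s_def)
  \<comment> \<open>The scale invariant bound on \<open>Q powr s\<close>, solved for \<open>Q\<close>.\<close>
  have root: "Q x \<le> \<delta> * norm x powr (- 2 * (1 / s))"
    if "0 < norm x" "0 < \<delta>" "(norm x)\<^sup>2 * Q x powr s \<le> \<delta> powr s" for x \<delta>
  proof -
    have "(\<delta> * norm x powr (- 2 * (1 / s))) powr s = \<delta> powr s / (norm x)\<^sup>2"
    proof -
      have "- 2 * (1 / s) * s = - 2" using s by simp
      then have "(\<delta> * norm x powr (- 2 * (1 / s))) powr s = \<delta> powr s * norm x powr (- 2)"
        using that by (simp only: powr_mult powr_powr)
      then show ?thesis using that by (simp add: powr_minus divide_inverse)
    qed
    then have "Q x powr s \<le> (\<delta> * norm x powr (- 2 * (1 / s))) powr s"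
      using that by (simp only:) (simp add: pos_le_divide_eq mult.commute)
    then show ?thesis
      using s Q_nonneg[of x] that(2) powr_less_mono2[of s "\<delta> * norm x powr (- 2 * (1 / s))" "Q x"]
      by (meson mult_nonneg_nonneg less_imp_le powr_ge_zero not_less)
  qed
  have crit: "1 - ?n / 2 + ?n / (q + 1) \<noteq> 0"
  proof
    assume "1 - ?n / 2 + ?n / (q + 1) = 0"
    then have "q * (?n - 2) = ?n + 2" using q_gt_1 n by (simp add: field_simps)
    then have "q = (?n + 2) / (?n - 2)" using n by (simp add: field_simps)
    then show False using noncrit by simp
  qed
  have "1 / s * 2 \<noteq> ?n - 2"
  proof
    assume "1 / s * 2 = ?n - 2"
    then have "s * (?n - 2) = 2" using s by (simp add: field_simps)
    then have "q * (?n - 2) = ?n + 2" by (simp add: q algebra_simps)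
    then have "q = (?n + 2) / (?n - 2)" using n by (simp add: field_simps)
    then show False using noncrit by simp
  qed
  then consider (sub) "?n - 2 < 2 * (1 / s)" | (super) "2 * (1 / s) < ?n - 2" by linarith
  then show ?thesis
  proof cases
    case sub
    obtain R where R: "0 < R" "\<forall>x. R \<le> norm x \<longrightarrow> (norm x)\<^sup>2 * Q x powr s \<le> 1"
      using decay[of 1] by auto
    show ?thesis
    proof (rule trivial_if_fast_decay[OF crit _ sub R(1), of 1])
      show "Q x \<le> 1 * norm x powr (- 2 * (1 / s))" if "R \<le> norm x" for x
        using that R by (intro root) auto
    qed (use R s in \<open>auto simp: s_def\<close>)
  next
    case super
    define \<alpha> \<beta> where "\<alpha> = 1 / s" and "\<beta> = ?n - 2 - 1 / s"
    have \<alpha>: "0 < \<alpha>" using s by (simp add: \<alpha>_def)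
    have \<beta>: "0 < \<beta>" "?n - 2 < 2 * \<beta>" using super n by (auto simp: \<beta>_def)
    define \<kappa> where "\<kappa> = \<alpha> * \<beta> / 2"
    have \<kappa>: "0 < \<kappa>" "\<kappa> < \<alpha> * \<beta>" using \<alpha> \<beta> by (auto simp: \<kappa>_def)
    \<comment> \<open>Small enough for the comparison lemma; the bound by \<open>1\<close> serves the scaling hypothesis of the
      vanishing result.\<close>
    define \<delta> where "\<delta> = min 1 (2 * \<kappa> / (K + 1))"
    have \<delta>: "0 < \<delta>" "\<delta> \<le> 1" "K * \<delta> \<le> 2 * \<kappa>"
    proof -
      show "0 < \<delta>" "\<delta> \<le> 1" using \<kappa> K by (auto simp: \<delta>_def)
      have "(K + 1) * \<delta> \<le> (K + 1) * (2 * \<kappa> / (K + 1))"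
        using K by (intro mult_left_mono) (auto simp: \<delta>_def)
      also have "\<dots> = 2 * \<kappa>" using K by simp
      finally show "K * \<delta> \<le> 2 * \<kappa>" using \<open>0 < \<delta>\<close> by (simp add: algebra_simps)
    qed
    obtain R where R: "0 < R" "\<forall>x. R \<le> norm x \<longrightarrow> (norm x)\<^sup>2 * Q x powr s \<le> \<delta>"
      using decay[OF \<delta>(1)] by auto
    have "\<exists>C. \<forall>x. R \<le> norm x \<longrightarrow> Q x \<le> C * norm x powr (- 2 * \<beta>)"
    proof (rule exterior_decay[OF Q_C2 Q_nonneg \<alpha> \<beta>(1) _ R(1) \<kappa>(2)])
      show "\<alpha> + \<beta> = ?n - 2" by (simp add: \<alpha>_def \<beta>_def)
    next
      fix x :: 'a assume x: "R \<le> norm x"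
      then have x0: "0 < x \<bullet> x" using R(1) by auto
      have "K * Q x powr s * (x \<bullet> x) \<le> K * \<delta>"
        using R(2) x K mult_left_mono[of "(norm x)\<^sup>2 * Q x powr s" \<delta> K]
        by (simp add: dot_square_norm ac_simps)
      with \<delta> have "K * Q x powr s \<le> 2 * \<kappa> / (x \<bullet> x)"
        using x0 by (simp add: pos_le_divide_eq)
      then have "(Q x)\<^sup>2 * (K * Q x powr s) \<le> (Q x)\<^sup>2 * (2 * \<kappa> / (x \<bullet> x))"
        by (intro mult_left_mono) auto
      also have "(Q x)\<^sup>2 * (K * Q x powr s) = K * Q x powr (1 + s) * Q x"
        using Q_nonneg[of x] by (cases "Q x = 0") (auto simp: powr_add power2_eq_square)
      finally have "2 * (K * Q x powr (1 + s) * Q x) \<le> 2 * ((Q x)\<^sup>2 * (2 * \<kappa> / (x \<bullet> x)))"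
        by linarith
      also have "\<dots> = 4 * \<kappa> * (Q x)\<^sup>2 / (x \<bullet> x)" by simp
      finally have 1: "2 * (K * Q x powr (1 + s) * Q x) \<le> 4 * \<kappa> * (Q x)\<^sup>2 / (x \<bullet> x)" .
      have "Q x * (- K * Q x powr (1 + s)) \<le> Q x * (2 * (q + 1) * P (V x))"
        by (intro mult_left_mono P_ge Q_nonneg)
      moreover have "2 * Q x * lap Q'' x = 4 * Q x * energy x + 2 * (Q x * (2 * (q + 1) * P (V x)))"
        by (simp add: lap_Q algebra_simps)
      ultimately show "(\<Sum>b\<in>Basis. (Q' x b)\<^sup>2) - 4 * \<kappa> * (Q x)\<^sup>2 / (x \<bullet> x) \<le> 2 * Q x * lap Q'' x"
        using 1 gradient_Q[of x] by (simp add: algebra_simps)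
    next
      fix \<eta> :: real assume \<eta>: "0 < \<eta>"
      then obtain r where r: "0 < r" "\<forall>x. r \<le> norm x \<longrightarrow> (norm x)\<^sup>2 * Q x powr s \<le> \<eta> powr s"
        using decay[of "\<eta> powr s"] by auto
      have "Q x \<le> \<eta> * norm x powr (- 2 * \<alpha>)" if "r \<le> norm x" for x
        unfolding \<alpha>_def using r that \<eta> by (intro root) auto
      then show "\<exists>r. \<forall>x. r \<le> norm x \<longrightarrow> Q x \<le> \<eta> * norm x powr (- 2 * \<alpha>)" by blast
    qed
    then obtain C where C: "\<forall>x. R \<le> norm x \<longrightarrow> Q x \<le> C * norm x powr (- 2 * \<beta>)" by blast
    show ?thesis
      by (rule trivial_if_fast_decay[OF crit \<beta> R(1)])
         (use C R(2) \<delta>(2) in \<open>auto simp: s_def intro: order_trans\<close>)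
  qed
qed

text \<open>
  \<open>Q\<close> is at most a constant times \<open>(norm (V x))\<^sup>2\<close>, so the \<open>p\<close>-th power of \<open>norm (V x)\<close> dominates.
\<close>

lemma Q_powr_integrable:
  assumes p: "0 < p" and V: "in_Lp p V"
  shows "(\<lambda>x. Q x powr (p / 2)) integrable_on UNIV"
proof -
  obtain c where c: "0 < c" "\<And>v. norm (T v) \<le> norm v * c"
    using bounded_linear.pos_bounded[OF linear_conv_bounded_linear[THEN iffD1, OF T_linear]] by auto
  show ?thesis
  proof (rule integrable_on_lebesgue, rule Bochner_Integration.integrable_bound)
    show "integrable lebesgue (\<lambda>x. c powr (p / 2) * norm (V x) powr p)"
      using V by (simp add: in_Lp_def)
    have "(\<lambda>x. Q x powr (p / 2)) \<in> borel_measurable borel"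
      using p by (intro borel_measurable_continuous_onI continuous_on_powr_const C2_deriv_cont0[OF Q_C2] Q_nonneg) simp
    then show "(\<lambda>x. Q x powr (p / 2)) \<in> borel_measurable lebesgue"
      by (simp add: measurable_completion)
    have "Q x powr (p / 2) \<le> c powr (p / 2) * norm (V x) powr p" for x
    proof -
      have "Q x \<le> norm (V x) * norm (T (V x))" unfolding Q_def by (rule norm_cauchy_schwarz)
      also have "\<dots> \<le> norm (V x) * (norm (V x) * c)" using c by (intro mult_left_mono) auto
      finally have "Q x powr (p / 2) \<le> (c * (norm (V x))\<^sup>2) powr (p / 2)"
        using p Q_nonneg by (intro powr_mono2) (auto simp: power2_eq_square ac_simps)
      also have "\<dots> = c powr (p / 2) * norm (V x) powr p"
        using c by (cases "V x = 0") (auto simp: powr_mult powr_powr simp flip: powr_numeral)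
      finally show ?thesis .
    qed
    then show "AE x in lebesgue. norm (Q x powr (p / 2)) \<le> norm (c powr (p / 2) * norm (V x) powr p)"
      by (auto simp: c(1))
  qed
qed

end

section \<open>The system in coordinates\<close>

lemma partial_deriv_eq:
  fixes f :: "real^'n::finite \<Rightarrow> real"
  assumes "(f has_derivative f') (at x)"
  shows "partial_deriv k f x = f' (axis k 1)"
  using assms partial_deriv_eq_frechet_derivative[of f x k] frechet_derivative_at[OF assms]
  by (auto simp: differentiable_def)

lemma laplacian_component:
  fixes V :: "real^'n::finite \<Rightarrow> real^'m::finite"
  assumes V: "C2_deriv V V' V''"
  shows "laplacian (\<lambda>y. V y $ j) x = lap V'' x $ j"
proof -
  have c: "((\<lambda>x. f x $ j) has_derivative (\<lambda>v. f' v $ j)) (at x)"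
    if "(f has_derivative f') (at x)" for f :: "real^'n \<Rightarrow> real^'m" and f' x
    using bounded_linear.has_derivative[OF bounded_linear_vec_nth that] .
  have 1: "partial_deriv k (\<lambda>y. V y $ j) = (\<lambda>x. V' x (axis k 1) $ j)" for k
    using partial_deriv_eq[OF c[OF C2_deriv_D1[OF V]]] by auto
  have B: "(Basis :: (real^'n) set) = range (\<lambda>k. axis k 1)"
    by (auto simp: Basis_vec_def)
  have "inj (\<lambda>k. axis k 1 :: real^'n)"
    by (auto simp: inj_on_def axis_eq_axis)
  then have "lap V'' x $ j = (\<Sum>k\<in>UNIV. V'' x (axis k 1) (axis k 1) $ j)"
    unfolding lap_def B by (simp add: sum.reindex)
  also have "\<dots> = laplacian (\<lambda>y. V y $ j) x"
    unfolding laplacian_def 1 by (intro sum.cong refl) (simp add: partial_deriv_eq[OF c[OF C2_deriv_D2[OF V]]])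
  finally show ?thesis by simp
qed

theorem theorem2:
  fixes q p :: real
    and A :: "real^'m^'m"
    and P :: "real^'m \<Rightarrow> real"
    and V :: "real^'n \<Rightarrow> real^'m"
  assumes "CARD('n) \<ge> 3"
    and "q > (real CARD('n) + 2) / real CARD('n)"
    and "q \<noteq> (real CARD('n) + 2) / (real CARD('n) - 2)"
    and "p = real CARD('n) / 2 * (q - 1)"
    and "transpose A = A"
    and "positive_definite A"
    and "C_k 2 P"
    and "pos_homogeneous (q + 1) P"
    and "C_k 2 V"
    and "\<And>x i. (\<Sum>j\<in>UNIV. A $ i $ j * laplacian (\<lambda>y. V y $ j) x) = partial_deriv i P (V x)"
    and "in_Lp p V"
  shows "\<forall>x. V x = 0"
proof -
  let ?n = "real CARD('n)"
  have n: "3 \<le> ?n" using assms(1) by simp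
  have "1 < (?n + 2) / ?n" using n by (simp add: field_simps)
  with assms(2) have q: "1 < q" by linarith
  obtain P' P'' where P: "C2_deriv P P' P''" using C_k_2_imp_C2_deriv[OF assms(7)] by blast
  obtain V' V'' where V: "C2_deriv V V' V''" using C_k_2_imp_C2_deriv[OF assms(9)] by blast
  have sys: "(A *v lap V'' x) \<bullet> w = P' (V x) w" for x w
  proof -
    have "(A *v lap V'' x) $ i = P' (V x) (axis i 1)" for i
      using assms(10)[of i x] partial_deriv_eq[OF C2_deriv_D1[OF P]]
      by (simp add: laplacian_component[OF V] matrix_vector_mult_def)
    then have "(A *v lap V'' x) \<bullet> w = (\<Sum>i\<in>UNIV. w $ i * P' (V x) (axis i 1))"
      by (simp add: inner_vec_def mult.commute)
    also have "\<dots> = P' (V x) (\<Sum>i\<in>UNIV. w $ i *\<^sub>R axis i 1)"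
      using C2_deriv_linear1[OF P] by (simp add: linear_sum linear_cmul)
    also have "(\<Sum>i\<in>UNIV. w $ i *\<^sub>R axis i 1) = w"
      using basis_expansion[of w] by (simp add: scalar_mult_eq_scaleR)
    finally show ?thesis .
  qed
  interpret homogeneous_system "(*v) A" P P' V V' V'' q
  proof (rule homogeneous_system.intro)
    show "linear ((*v) A)" by (rule matrix_vector_mul_linear)
    show "u \<bullet> (A *v v) = v \<bullet> (A *v u)" for u v
      using assms(5) by (metis dot_lmul_matrix inner_commute transpose_matrix_vector)
    show "0 < v \<bullet> (A *v v)" if "v \<noteq> 0" for v
      using assms(6) that by (simp add: positive_definite_def)
  qed (use q assms(8) V sys C2_deriv_D1[OF P] in auto)
  have p: "0 < p" "p / 2 = real DIM(real^'n) * ((q - 1) / 2) / 2"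
    using q n by (simp_all add: assms(4))
  have "V x = 0" for x
  proof (rule trivial_if_integrable)
    show "3 \<le> DIM(real^'n)" using assms(1) by simp
    show "q \<noteq> (real DIM(real^'n) + 2) / (real DIM(real^'n) - 2)" using assms(3) by simp
    show "(\<lambda>x. Q x powr (real DIM(real^'n) * ((q - 1) / 2) / 2)) integrable_on UNIV"
      using Q_powr_integrable[OF p(1) assms(11)] unfolding p(2) .
  qed
  then show ?thesis by simp
qed

end
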